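(* Let $R:S^1\to\mathbb{R}$ satisfy the standing assumptions in the context, and let $\mathrm{Vol}(\Gamma_{\mathrm{red}})=2\pi\int_{R>0}|R'(y)|/\sqrt{R(y)}\,dy$ be the (finite) symplectic volume of the reduced phase space, equivalently $4\pi$ times the total variation of $\sqrt R$ over the subset of $S^1$ on which $R>0$. Then, as $\hbar\to0^+$ (through values of $\hbar$ for which $\mathcal{P}_\hbar$ satisfies the divisibility assumption in the context), the dimension of $\mathcal{H}_{\mathrm{RAQ},\hbar}^{1}$ is asymptotic to $(2\pi\hbar)^{-1}\,\mathrm{Vol}(\Gamma_{\mathrm{red}})$, i.e. $$\lim_{\hbar\to0^+} 2\pi\hbar\,\dim\mathcal{H}_{\mathrm{RAQ},\hbar}^{1}=\mathrm{Vol}(\Gamma_{\mathrm{red}}),$$ while the dimension of the orthogonal complement of $\mathcal{H}_{\mathrm{RAQ},\hbar}^{1}$ in $\mathcal{H}_{\mathrm{RAQ},\hbar}^{\mathrm{tot}}$ remains bounded.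
   Context: $S^1=\mathbb{R}/2\pi\mathbb{Z}$; $x,y\in S^1$. Standing assumptions on $R:S^1\to\mathbb{R}$: $R$ is smooth, is positive somewhere, has at most finitely many stationary points (points with $R'=0$), at each stationary point some derivative of $R$ (of order $\ge 1$) is nonvanishing, and no zero of $R$ is a stationary point. $\Phi$ is the space of functions $f(x,y)=\sum_{m\in\mathbb{Z}}e^{imx}f_m(y)$ on $S^1\times S^1$ with each $f_m:S^1\to\mathbb{C}$ smooth and only finitely many $f_m$ nonzero; $\Phi^*$ is its algebraic dual. For $\hbar>0$ the quantum constraint is $-\hbar^2\partial^2/\partial x^2-R(y)$, and one considers solutions $y\in S^1$ of $\hbar^2q^2=R(y)$ with $q$ a non-negative integer. The order of such a solution is the order $p\ge1$ of the lowest nonvanishing derivative (of order $\ge1$) of $R$ at $y$. For odd $p$, $Y^\hbar_p(q)$ is the set of solutions of order $p$; for even $p$ and $\epsilon\in\{1,-1\}$, $Y^\hbar_{p\epsilon}(q)$ is the set of solutions of order $p$ at which $R^{(p)}(y)$ has sign $\epsilon$. $\mathcal{P}_\hbar$ is the set of all orders occurring, over all $q$. Divisibility assumption: if $p\in\mathcal{P}_\hbar$, then $\mathcal{P}_\hbar$ contains no factors (positive divisors) of $p$ smaller than $p/2$. Define antilinear maps $\Phi\to\Phi^*$ by $$\eta_p(f)[g]=(2\pi)^2\sum_{m\in\mathbb{Z}}\sum_{y\in Y^\hbar_p(|m|)}\frac{\overline{f_m(y)}\,g_m(y)}{|R^{(p)}(y)|^{1/p}}\ (p\text{ odd}),\qquad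 \eta_{p\epsilon}(f)[g]=(2\pi)^2\sum_{m\in\mathbb{Z}}\sum_{y\in Y^\hbar_{p\epsilon}(|m|)}\frac{\overline{f_m(y)}\,g_m(y)}{|R^{(p)}(y)|^{1/p}}\ (p\text{ even}).$$ The Hilbert spaces $\mathcal{H}^{p}_{\mathrm{RAQ},\hbar}:=\eta_p(\Phi)$ and $\mathcal{H}^{p\epsilon}_{\mathrm{RAQ},\hbar}:=\eta_{p\epsilon}(\Phi)$ carry the inner products $(\eta(\phi_1),\eta(\phi_2)):=\eta(\phi_2)[\phi_1]$ (with $\eta=\eta_p$ or $\eta_{p\epsilon}$ respectively), and $\mathcal{H}^{\mathrm{tot}}_{\mathrm{RAQ},\hbar}$ is the orthogonal direct sum of all $\mathcal{H}^{p}_{\mathrm{RAQ},\hbar}$ ($p\in\mathcal{P}_\hbar$ odd) and all $\mathcal{H}^{p\epsilon}_{\mathrm{RAQ},\hbar}$ ($p\in\mathcal{P}_\hbar$ even, $\epsilon=\pm1$ occurring). The reduced phase space $\Gamma_{\mathrm{red}}$ is the quotient of the constraint surface $\{p_x^2=R(y)\}\subset T^*(S^1\times S^1)$ by the orbits of the Hamiltonian flow of $p_x^2-R(y)$. *)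

theory Defs
  imports "HOL-Analysis.Analysis" "HOL-Library.Function_Algebras"
begin

section \<open>Functions on the circle\<close>

text \<open>A function on the circle is a \<open>2\<pi>\<close>-periodic function on the line; the points of the
  circle are represented by \<open>[0, 2\<pi>)\<close>.\<close>

definition circle :: "real set" where
  "circle = {0..<2 * pi}"

definition smooth :: "(real \<Rightarrow> 'a::real_normed_vector) \<Rightarrow> bool" where
  "smooth f \<longleftrightarrow>
    (\<exists>D. D 0 = f \<and> (\<forall>n x. (D n has_vector_derivative D (Suc n) x) (at x)))"

definition smooth_on_circle :: "(real \<Rightarrow> 'a::real_normed_vector) \<Rightarrow> bool" where
  "smooth_on_circle f \<longleftrightarrow> smooth f \<and> (\<forall>y. f (y + 2 * pi) = f y)"

text \<open>The total variation of \<open>f\<close> over a set \<open>U\<close> that need not be connected: the supremum over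
  finite families of non-overlapping compact intervals contained in \<open>U\<close>. Cutting the circle
  at \<open>0\<close> is harmless here, since splitting an interval can only increase the sum.\<close>

definition total_variation :: "real set \<Rightarrow> (real \<Rightarrow> real) \<Rightarrow> ennreal" where
  "total_variation U f =
    (SUP d\<in>{d. d division_of \<Union>d \<and> \<Union>d \<subseteq> U}. ennreal (\<Sum>K\<in>d. \<bar>f (Sup K) - f (Inf K)\<bar>))"

section \<open>The test space\<close>

definition mode_family :: "(int \<Rightarrow> real \<Rightarrow> complex) \<Rightarrow> bool" where
  "mode_family F \<longleftrightarrow> finite {m. F m \<noteq> 0} \<and> (\<forall>m. smooth_on_circle (F m))"

definition mode_sum :: "(int \<Rightarrow> real \<Rightarrow> complex) \<Rightarrow> real \<Rightarrow> real \<Rightarrow> complex" where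
  "mode_sum F = (\<lambda>x y. \<Sum>m | F m \<noteq> 0. exp (\<i> * of_int m * of_real x) * F m y)"

definition Phi :: "(real \<Rightarrow> real \<Rightarrow> complex) set" where
  "Phi = mode_sum ` {F. mode_family F}"

text \<open>\<open>modes f m\<close> is the coefficient function \<open>f\<^sub>m\<close>; see \<open>modes_mode_sum\<close> below.\<close>

definition modes :: "(real \<Rightarrow> real \<Rightarrow> complex) \<Rightarrow> int \<Rightarrow> real \<Rightarrow> complex" where
  "modes f = (THE F. mode_family F \<and> mode_sum F = f)"

lemma trig_sum_eq_0:
  fixes c :: "int \<Rightarrow> complex"
  assumes "finite A" and "\<And>x::real. (\<Sum>m\<in>A. exp (\<i> * of_int m * of_real x) * c m) = 0"
    and "k \<in> A"
  shows "c k = 0"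
proof -
  have ex: "((\<lambda>x. exp (\<i> * of_int n * of_real x)) has_integral (if n = 0 then 2 * pi else 0))
      {0..2 * pi}" for n :: int
  proof (cases "n = 0")
    case True
    then show ?thesis
      using has_integral_const_real[of "1::complex" 0 "2 * pi"] by (simp add: scaleR_conv_of_real)
  next
    case False
    let ?G = "\<lambda>x::real. exp (\<i> * of_int n * of_real x) / (\<i> * of_int n)"
    have "((\<lambda>x. exp (\<i> * of_int n * of_real x)) has_integral ?G (2 * pi) - ?G 0) {0..2 * pi}"
    proof (rule fundamental_theorem_of_calculus)
      fix x :: real
      have "((\<lambda>z. exp (\<i> * of_int n * z) / (\<i> * of_int n)) has_field_derivative
          exp (\<i> * of_int n * of_real x)) (at (of_real x))"
        using False by (auto intro!: derivative_eq_intros)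
      then show "(?G has_vector_derivative exp (\<i> * of_int n * of_real x)) (at x within {0..2 * pi})"
        by (rule has_vector_derivative_real_field)
    qed simp
    moreover have "?G (2 * pi) - ?G 0 = 0"
    proof -
      have "exp (\<i> * of_int n * of_real (2 * pi)) = 1"
        using exp_integer_2pi[of "of_int n"] by (simp add: mult_ac)
      then show ?thesis by simp
    qed
    ultimately show ?thesis using False by simp
  qed
  have "((\<lambda>x. \<Sum>m\<in>A. c m * exp (\<i> * of_int (m - k) * of_real x)) has_integral
      (\<Sum>m\<in>A. c m * (if m - k = 0 then 2 * pi else 0))) {0..2 * pi}"
  proof (rule has_integral_sum[OF assms(1)])
    fix m
    show "((\<lambda>x. c m * exp (\<i> * of_int (m - k) * of_real x)) has_integral
        c m * (if m - k = 0 then 2 * pi else 0)) {0..2 * pi}"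
      using has_integral_mult_right[OF ex[of "m - k"], of "c m"] by simp
  qed
  moreover have "(\<Sum>m\<in>A. c m * exp (\<i> * of_int (m - k) * of_real x)) = 0" for x :: real
  proof -
    have "(\<Sum>m\<in>A. c m * exp (\<i> * of_int (m - k) * of_real x)) =
        exp (- (\<i> * of_int k * of_real x)) * (\<Sum>m\<in>A. exp (\<i> * of_int m * of_real x) * c m)"
      unfolding sum_distrib_left
      by (intro sum.cong refl) (simp add: exp_diff exp_minus field_simps)
    then show ?thesis using assms(2) by simp
  qed
  ultimately have "(\<Sum>m\<in>A. c m * (if m - k = 0 then 2 * pi else 0)) = 0"
    using has_integral_unique[OF _ has_integral_0] by simp
  also have "(\<Sum>m\<in>A. c m * (if m - k = 0 then 2 * pi else 0)) = c k * (2 * pi)"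
  proof -
    have "(\<Sum>m\<in>A. c m * (if m - k = 0 then 2 * pi else 0)) =
        (\<Sum>m\<in>A. if k = m then c m * (2 * pi) else 0)"
      by (intro sum.cong) auto
    then show ?thesis using assms(1,3) by (simp add: sum.delta)
  qed
  finally show ?thesis by simp
qed

lemma mode_sum_inj:
  assumes "mode_family F" "mode_family G" "mode_sum F = mode_sum G"
  shows "F = G"
proof (intro ext)
  fix k y
  let ?A = "insert k ({m. F m \<noteq> 0} \<union> {m. G m \<noteq> 0})"
  have fin: "finite ?A" using assms(1,2) by (simp add: mode_family_def)
  have ext: "mode_sum H x y = (\<Sum>m\<in>?A. exp (\<i> * of_int m * of_real x) * H m y)"
    if "H = F \<or> H = G" for H x
    unfolding mode_sum_def using fin that by (intro sum.mono_neutral_left) auto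
  have "(\<Sum>m\<in>?A. exp (\<i> * of_int m * of_real x) * (F m y - G m y)) = 0" for x
    using ext[of F x] ext[of G x] assms(3) by (simp add: right_diff_distrib sum_subtractf)
  from trig_sum_eq_0[OF fin this, of k] show "F k y = G k y" by simp
qed

lemma modes_mode_sum: "mode_family F \<Longrightarrow> modes (mode_sum F) = F"
  unfolding modes_def by (rule the_equality) (auto dest: mode_sum_inj)

section \<open>Solutions of the quantum constraint\<close>

definition solution_order :: "(real \<Rightarrow> real) \<Rightarrow> real \<Rightarrow> nat" where
  "solution_order R y = (LEAST p. 1 \<le> p \<and> (deriv ^^ p) R y \<noteq> 0)"

definition solutions :: "(real \<Rightarrow> real) \<Rightarrow> real \<Rightarrow> nat \<Rightarrow> real set" where
  "solutions R h q = {y \<in> circle. h\<^sup>2 * (real q)\<^sup>2 = R y}"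

definition orders :: "(real \<Rightarrow> real) \<Rightarrow> real \<Rightarrow> nat set" where
  "orders R h = {solution_order R y | q y. y \<in> solutions R h q}"

definition divisibility :: "(real \<Rightarrow> real) \<Rightarrow> real \<Rightarrow> bool" where
  "divisibility R h \<longleftrightarrow>
    (\<forall>p\<in>orders R h. \<not> (\<exists>d\<in>orders R h. d dvd p \<and> real d < real p / 2))"

text \<open>Labels of the superselection sectors: \<open>p\<close> for odd \<open>p\<close>, and \<open>p\<epsilon>\<close> for even \<open>p\<close>.\<close>

datatype sector = Odd_Sector nat | Even_Sector nat int

primrec sector_order :: "sector \<Rightarrow> nat" where
  "sector_order (Odd_Sector p) = p"
| "sector_order (Even_Sector p e) = p"

primrec Y :: "(real \<Rightarrow> real) \<Rightarrow> real \<Rightarrow> sector \<Rightarrow> nat \<Rightarrow> real set" where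
  "Y R h (Odd_Sector p) q = {y \<in> solutions R h q. solution_order R y = p}"
| "Y R h (Even_Sector p e) q =
    {y \<in> solutions R h q. solution_order R y = p \<and> sgn ((deriv ^^ p) R y) = of_int e}"

definition sectors :: "(real \<Rightarrow> real) \<Rightarrow> real \<Rightarrow> sector set" where
  "sectors R h =
    {Odd_Sector p | p. p \<in> orders R h \<and> odd p} \<union>
    {Even_Sector p e | p e. p \<in> orders R h \<and> even p \<and> e \<in> {1, -1} \<and>
      (\<exists>q. Y R h (Even_Sector p e) q \<noteq> {})}"

section \<open>Rigging maps and Hilbert spaces\<close>

text \<open>A linear functional on \<open>Phi\<close> is represented by its extension by zero outside \<open>Phi\<close>, so
  that the algebraic dual is a space of functions under the pointwise operations.\<close>

type_synonym functional = "(real \<Rightarrow> real \<Rightarrow> complex) \<Rightarrow> complex"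

definition eta :: "(real \<Rightarrow> real) \<Rightarrow> real \<Rightarrow> sector \<Rightarrow> (real \<Rightarrow> real \<Rightarrow> complex) \<Rightarrow> functional" where
  "eta R h s f = (\<lambda>g. if g \<in> Phi then
      (2 * pi)\<^sup>2 * (\<Sum>m | modes f m \<noteq> 0. \<Sum>y\<in>Y R h s (nat \<bar>m\<bar>).
        cnj (modes f m y) * modes g m y /
        of_real (\<bar>(deriv ^^ sector_order s) R y\<bar> powr (1 / real (sector_order s))))
    else 0)"

definition H_RAQ :: "(real \<Rightarrow> real) \<Rightarrow> real \<Rightarrow> sector \<Rightarrow> functional set" where
  "H_RAQ R h s = eta R h s ` Phi"

text \<open>The inner product \<open>(\<eta>(\<phi>\<^sub>1), \<eta>(\<phi>\<^sub>2)) = \<eta>(\<phi>\<^sub>2)[\<phi>\<^sub>1]\<close>; \<open>inner_RAQ_eta\<close> below shows that it does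
  not depend on the representatives.\<close>

definition inner_RAQ ::
    "(real \<Rightarrow> real) \<Rightarrow> real \<Rightarrow> sector \<Rightarrow> functional \<Rightarrow> functional \<Rightarrow> complex" where
  "inner_RAQ R h s a b = (THE c. \<exists>\<phi>1\<in>Phi. \<exists>\<phi>2\<in>Phi.
      a = eta R h s \<phi>1 \<and> b = eta R h s \<phi>2 \<and> c = eta R h s \<phi>2 \<phi>1)"

text \<open>The orthogonal direct sum consists of families indexed by the sectors. Only finitely many
  sectors occur, so no completion is needed.\<close>

definition H_tot :: "(real \<Rightarrow> real) \<Rightarrow> real \<Rightarrow> (sector \<Rightarrow> functional) set" where
  "H_tot R h = {\<psi>. finite {s. \<psi> s \<noteq> 0} \<and>
      (\<forall>s\<in>sectors R h. \<psi> s \<in> H_RAQ R h s) \<and> (\<forall>s. s \<notin> sectors R h \<longrightarrow> \<psi> s = 0)}"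

definition inner_tot ::
    "(real \<Rightarrow> real) \<Rightarrow> real \<Rightarrow> (sector \<Rightarrow> functional) \<Rightarrow> (sector \<Rightarrow> functional) \<Rightarrow> complex" where
  "inner_tot R h \<psi> \<phi> = (\<Sum>s | \<psi> s \<noteq> 0. inner_RAQ R h s (\<psi> s) (\<phi> s))"

definition sector_embed :: "sector \<Rightarrow> functional \<Rightarrow> sector \<Rightarrow> functional" where
  "sector_embed s a = (\<lambda>t. if t = s then a else 0)"

definition complement_RAQ :: "(real \<Rightarrow> real) \<Rightarrow> real \<Rightarrow> sector \<Rightarrow> (sector \<Rightarrow> functional) set" where
  "complement_RAQ R h s =
    {\<psi> \<in> H_tot R h. \<forall>a\<in>H_RAQ R h s. inner_tot R h (sector_embed s a) \<psi> = 0}"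

lemma eta_hermitian:
  assumes "f \<in> Phi" "g \<in> Phi"
  shows "eta R h s f g = cnj (eta R h s g f)"
proof -
  let ?w = "\<lambda>y. of_real (\<bar>(deriv ^^ sector_order s) R y\<bar> powr (1 / real (sector_order s))) :: complex"
  let ?t = "\<lambda>u v m. \<Sum>y\<in>Y R h s (nat \<bar>m\<bar>). cnj (modes u m y) * modes v m y / ?w y"
  let ?S = "{m. modes f m \<noteq> 0} \<union> {m. modes g m \<noteq> 0}"
  have fin: "finite ?S"
    using assms by (auto simp: Phi_def modes_mode_sum mode_family_def)
  have 1: "(\<Sum>m | modes f m \<noteq> 0. ?t f g m) = (\<Sum>m\<in>?S. ?t f g m)"
    using fin by (intro sum.mono_neutral_left) auto
  have 2: "(\<Sum>m | modes g m \<noteq> 0. ?t g f m) = (\<Sum>m\<in>?S. ?t g f m)"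
    using fin by (intro sum.mono_neutral_left) auto
  have 3: "?t f g m = cnj (?t g f m)" for m
    unfolding cnj_sum by (intro sum.cong refl) simp
  have "eta R h s f g = (2 * pi)\<^sup>2 * (\<Sum>m\<in>?S. ?t f g m)"
    unfolding eta_def 1 using assms by simp
  also have "\<dots> = cnj ((2 * pi)\<^sup>2 * (\<Sum>m\<in>?S. ?t g f m))"
    unfolding 3 by simp
  also have "\<dots> = cnj (eta R h s g f)"
    unfolding eta_def 2 using assms by simp
  finally show ?thesis .
qed

lemma inner_RAQ_eta:
  assumes "f \<in> Phi" "g \<in> Phi"
  shows "inner_RAQ R h s (eta R h s f) (eta R h s g) = eta R h s g f"
  unfolding inner_RAQ_def
proof (rule the_equality)
  fix c
  assume "\<exists>\<phi>1\<in>Phi. \<exists>\<phi>2\<in>Phi. eta R h s f = eta R h s \<phi>1 \<and> eta R h s g = eta R h s \<phi>2 \<and>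
    c = eta R h s \<phi>2 \<phi>1"
  then obtain \<phi>1 \<phi>2 where *: "\<phi>1 \<in> Phi" "\<phi>2 \<in> Phi" "eta R h s f = eta R h s \<phi>1"
    "eta R h s g = eta R h s \<phi>2" "c = eta R h s \<phi>2 \<phi>1"
    by blast
  then have "c = eta R h s g \<phi>1" by simp
  also have "\<dots> = cnj (eta R h s \<phi>1 g)" using * assms by (intro eta_hermitian)
  also have "\<dots> = eta R h s g f" using eta_hermitian[OF assms(2,1)] *(3) by simp
  finally show "c = eta R h s g f" .
qed (use assms in blast)

section \<open>Complex dimensions\<close>

definition scale_functional :: "complex \<Rightarrow> functional \<Rightarrow> functional" where
  "scale_functional c a = (\<lambda>g. c * a g)"

definition scale_family :: "complex \<Rightarrow> (sector \<Rightarrow> functional) \<Rightarrow> sector \<Rightarrow> functional" where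
  "scale_family c \<psi> = (\<lambda>s. scale_functional c (\<psi> s))"

interpretation functionals: vector_space scale_functional
  by unfold_locales (auto simp: scale_functional_def fun_eq_iff algebra_simps)

interpretation families: vector_space scale_family
  by unfold_locales (auto simp: scale_family_def scale_functional_def fun_eq_iff algebra_simps)

text \<open>The library dimension of an infinite-dimensional space is \<open>0\<close>, hence the explicit
  finite-dimensionality predicates.\<close>

definition findim_functionals :: "functional set \<Rightarrow> bool" where
  "findim_functionals V \<longleftrightarrow> (\<exists>B. finite B \<and> V \<subseteq> functionals.span B)"

definition findim_families :: "(sector \<Rightarrow> functional) set \<Rightarrow> bool" where
  "findim_families V \<longleftrightarrow> (\<exists>B. finite B \<and> V \<subseteq> families.span B)"

section \<open>Reduced phase space volume and the semiclassical limit\<close>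

definition positive_part :: "(real \<Rightarrow> real) \<Rightarrow> real set" where
  "positive_part R = {y \<in> circle. R y > 0}"

definition reduced_volume :: "(real \<Rightarrow> real) \<Rightarrow> real" where
  "reduced_volume R = 2 * pi * (LBINT y:positive_part R. \<bar>deriv R y\<bar> / sqrt (R y))"

definition semiclassical :: "(real \<Rightarrow> real) \<Rightarrow> real filter" where
  "semiclassical R = (at 0 within {h. 0 < h \<and> divisibility R h})"

end

theory Submission
  imports Defs
begin

text \<open>The rigging map of a sector is supported on finitely many points \<open>(m, y)\<close> with
  \<open>\<hbar> \<bar>m\<bar> = sqrt (R y)\<close>, and evaluations at distinct points are linearly independent on the test
  space, so the dimension of a sector is the number of its points. On an interval where
  \<open>R' \<noteq> 0\<close>, \<open>sqrt R\<close> is monotone, so each \<open>m\<close> occurs at most once, and the points are counted by the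
  integers \<open>m\<close> with \<open>\<hbar> \<bar>m\<bar>\<close> in the range of \<open>sqrt R\<close>: their number is \<open>2 / \<hbar>\<close> times the variation, up
  to a bounded error. Finitely many such intervals cover the circle. All the other sectors
  live over the finitely many stationary points of \<open>R\<close>, each of which carries at most the two
  modes \<open>m\<close> and \<open>- m\<close>.\<close>

section \<open>Counting the regular solutions\<close>

text \<open>The nonnegative integers in an interval are counted by its length up to an error of 1,
  and the sign of \<open>m\<close> doubles both. The upper bound uses the closed range and the lower
  bound the open range, because it is left open whether the end values are hit by a lattice
  point.\<close>

lemma card_integers_between:
  fixes a b :: real
  assumes "0 \<le> a" "a \<le> b"
  shows "finite {m::int. a \<le> \<bar>of_int m\<bar> \<and> \<bar>of_int m\<bar> \<le> b}"
    and "real (card {m::int. a \<le> \<bar>of_int m\<bar> \<and> \<bar>of_int m\<bar> \<le> b}) \<le> 2 * (b - a) + 2"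
    and "2 * (b - a) - 2 \<le> real (card {m::int. a < \<bar>of_int m\<bar> \<and> \<bar>of_int m\<bar> < b})"
proof -
  define A where "A = {\<lceil>a\<rceil>..\<lfloor>b\<rfloor>}"
  define B where "B = {\<lfloor>a\<rfloor> + 1..\<lceil>b\<rceil> - 1}"
  have sub_A: "{m::int. a \<le> \<bar>of_int m\<bar> \<and> \<bar>of_int m\<bar> \<le> b} \<subseteq> A \<union> uminus ` A"
  proof
    fix m :: int
    assume "m \<in> {m. a \<le> \<bar>of_int m\<bar> \<and> \<bar>of_int m\<bar> \<le> b}"
    then have "\<lceil>a\<rceil> \<le> \<bar>m\<bar>" "\<bar>m\<bar> \<le> \<lfloor>b\<rfloor>" by (auto simp: ceiling_le_iff le_floor_iff)
    then have "m \<in> A \<or> - m \<in> A" by (auto simp: A_def)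
    then show "m \<in> A \<union> uminus ` A" by force
  qed
  then show fin: "finite {m::int. a \<le> \<bar>of_int m\<bar> \<and> \<bar>of_int m\<bar> \<le> b}"
    by (rule finite_subset) (simp add: A_def)
  have "card {m::int. a \<le> \<bar>of_int m\<bar> \<and> \<bar>of_int m\<bar> \<le> b} \<le> card (A \<union> uminus ` A)"
    by (rule card_mono[OF _ sub_A]) (simp add: A_def)
  also have "\<dots> \<le> card A + card (uminus ` A)" by (rule card_Un_le)
  also have "\<dots> = 2 * card A" by (simp add: card_image)
  finally have *: "real (card {m::int. a \<le> \<bar>of_int m\<bar> \<and> \<bar>of_int m\<bar> \<le> b}) \<le> 2 * real (card A)"
    by linarith
  have "real (card A) \<le> b - a + 1"
  \<comment> \<open>This guards the formula for the cardinality of an integer interval against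
    truncation at 0.\<close>
  proof (cases "\<lceil>a\<rceil> \<le> \<lfloor>b\<rfloor> + 1")
    case True
    then have "real (card A) = of_int \<lfloor>b\<rfloor> + 1 - of_int \<lceil>a\<rceil>" by (simp add: A_def)
    then show ?thesis by linarith
  qed (use assms in \<open>simp add: A_def\<close>)
  then have "2 * real (card A) \<le> 2 * (b - a) + 2" by (simp add: algebra_simps)
  with * show "real (card {m::int. a \<le> \<bar>of_int m\<bar> \<and> \<bar>of_int m\<bar> \<le> b}) \<le> 2 * (b - a) + 2"
    by (rule order_trans)
  have a0: "\<lfloor>a\<rfloor> \<ge> 0" using assms by simp
  have B_sub: "B \<union> uminus ` B \<subseteq> {m::int. a < \<bar>of_int m\<bar> \<and> \<bar>of_int m\<bar> < b}"
  proof
    fix x assume "x \<in> B \<union> uminus ` B"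
    then obtain m where "m \<in> B" and x: "x = m \<or> x = - m" by blast
    then have "\<lfloor>a\<rfloor> < m" "m < \<lceil>b\<rceil>" by (auto simp: B_def)
    then have "a < of_int m" "of_int m < b" "0 \<le> m"
      using a0 by (auto simp: floor_less_iff less_ceiling_iff)
    then show "x \<in> {m::int. a < \<bar>of_int m\<bar> \<and> \<bar>of_int m\<bar> < b}" using x by auto
  qed
  \<comment> \<open>Members of \<open>B\<close> are at least 1, since \<open>a\<close> has a
    nonnegative floor. So 0 does not occur and the two signs give different integers.\<close>
  have "B \<inter> uminus ` B = {}"
  proof -
    have "- m \<notin> B" if "m \<in> B" for m
    proof
      assume "- m \<in> B"
      then show False using that a0 unfolding B_def atLeastAtMost_iff by linarith
    qed
    then show ?thesis by auto
  qed
  then have "2 * card B = card (B \<union> uminus ` B)"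
    by (subst card_Un_disjoint) (auto simp: card_image B_def)
  also have "\<dots> \<le> card {m::int. a < \<bar>of_int m\<bar> \<and> \<bar>of_int m\<bar> < b}"
    by (rule card_mono[OF finite_subset[OF _ fin] B_sub]) auto
  finally have **: "2 * real (card B) \<le> real (card {m::int. a < \<bar>of_int m\<bar> \<and> \<bar>of_int m\<bar> < b})"
    by linarith
  have "b - a - 1 \<le> real (card B)"
  proof (cases "\<lfloor>a\<rfloor> + 1 \<le> \<lceil>b\<rceil>")
    case True
    then have "real (card B) = of_int \<lceil>b\<rceil> - 1 - of_int \<lfloor>a\<rfloor>" by (simp add: B_def)
    then show ?thesis by linarith
  next
    case False
    then have "\<lceil>b\<rceil> \<le> \<lfloor>a\<rfloor>" by simp
    then have "b \<le> a" by linarith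
    then show ?thesis by simp
  qed
  then have "2 * (b - a) - 2 \<le> 2 * real (card B)" by (simp add: algebra_simps)
  then show "2 * (b - a) - 2 \<le> real (card {m::int. a < \<bar>of_int m\<bar> \<and> \<bar>of_int m\<bar> < b})"
    using ** by (rule order_trans)
qed

section \<open>The clipped square root of \<open>R\<close> and the regular points\<close>

locale regular_symbol =
  fixes R :: "real \<Rightarrow> real"
  assumes smooth_R: "smooth_on_circle R"
    and finite_stationary: "finite {y \<in> circle. deriv R y = 0}"
    and finite_order: "\<And>y. deriv R y = 0 \<Longrightarrow> \<exists>k\<ge>1. (deriv ^^ k) R y \<noteq> 0"
begin

text \<open>Clipping at 0 makes the function continuous on the whole line and constant where
  \<open>R\<close> is not positive, so only the positive part contributes to its variation.\<close>

definition root :: "real \<Rightarrow> real" where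
  "root y = sqrt (max 0 (R y))"

text \<open>Away from the zeros of \<open>R\<close> this is the absolute value of the derivative of
  \<open>root\<close>; on the positive part it is half the integrand of
  \<open>reduced_volume\<close>.\<close>

definition speed :: "real \<Rightarrow> real" where
  "speed y = (if R y > 0 then \<bar>deriv R y\<bar> / (2 * sqrt (R y)) else 0)"

text \<open>The set \<open>S\<close> is arbitrary, so that the points over the circle can be counted
  piece by piece over subintervals.\<close>

definition lattice_points :: "real \<Rightarrow> real set \<Rightarrow> (int \<times> real) set" where
  "lattice_points h S = {(m, y). y \<in> S \<and> h\<^sup>2 * (of_int m)\<^sup>2 = R y \<and> deriv R y \<noteq> 0}"

lemma R_deriv: "(R has_real_derivative deriv R y) (at y)"
  and continuous_deriv_R: "continuous_on S (deriv R)"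
proof -
  obtain D where D: "D 0 = R" "\<And>n x. (D n has_real_derivative D (Suc n) x) (at x)"
    using smooth_R unfolding smooth_on_circle_def smooth_def has_real_derivative_iff_has_vector_derivative
    by auto
  have eq: "deriv R = D 1"
    using D(2)[of 0] D(1) by (auto intro!: DERIV_imp_deriv)
  show "(R has_real_derivative deriv R y) (at y)"
    using D(2)[of 0 y] D(1) eq by simp
  show "continuous_on S (deriv R)"
    unfolding eq using D(2)[of 1] by (meson DERIV_continuous_on DERIV_subset subset_UNIV)
qed

lemma continuous_R: "continuous_on S R"
  using R_deriv by (meson DERIV_continuous_on DERIV_subset subset_UNIV)

lemma continuous_root: "continuous_on S root"
  unfolding root_def by (intro continuous_intros continuous_R)

lemma root_pos: "root y > 0 \<longleftrightarrow> R y > 0"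
  by (simp add: root_def less_max_iff_disj)

text \<open>The sign of \<open>R\<close> persists near \<open>x\<close>, so \<open>root\<close>
  agrees locally with \<open>sqrt R\<close> or with 0. At a zero of \<open>R\<close> the derivative
  may fail to exist.\<close>

lemma root_deriv:
  assumes "R x \<noteq> 0"
  shows "(root has_real_derivative (if R x > 0 then deriv R x / (2 * sqrt (R x)) else 0)) (at x)"
proof (cases "R x > 0")
  case True
  have "\<forall>\<^sub>F y in nhds x. R y > 0"
    using continuous_R[of UNIV] True
    unfolding eventually_nhds
    by (intro exI[of _ "R -` {0<..}"]) (auto simp: continuous_on_open_vimage)
  then have ev: "\<forall>\<^sub>F y in nhds x. root y = sqrt (R y)"
    by eventually_elim (simp add: root_def)
  have "((\<lambda>y. sqrt (R y)) has_real_derivative deriv R x / (2 * sqrt (R x))) (at x)"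
    using True by (auto intro!: derivative_eq_intros R_deriv simp: field_simps)
  then show ?thesis using DERIV_cong_ev[OF refl ev refl] True by simp
next
  case False
  have "\<forall>\<^sub>F y in nhds x. R y < 0"
    unfolding eventually_nhds using False assms continuous_R[of UNIV]
    by (intro exI[of _ "R -` {..<0}"]) (auto simp: continuous_on_open_vimage)
  then have ev: "\<forall>\<^sub>F y in nhds x. root y = 0"
    by eventually_elim (simp add: root_def)
  show ?thesis using DERIV_cong_ev[OF refl ev refl] False by simp
qed

lemma lattice_points_Un:
  "lattice_points h (S \<union> T) = lattice_points h S \<union> lattice_points h T"
  and lattice_points_Int:
  "lattice_points h (S \<inter> T) = lattice_points h S \<inter> lattice_points h T"
  by (auto simp: lattice_points_def)

lemma modes_over_point:
  fixes h r :: real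
  assumes "h > 0"
  shows "finite {m::int. h\<^sup>2 * (of_int m)\<^sup>2 = r} \<and> card {m::int. h\<^sup>2 * (of_int m)\<^sup>2 = r} \<le> 2"
proof (cases "\<exists>k::int. h\<^sup>2 * (of_int k)\<^sup>2 = r")
  case True
  then obtain k :: int where k: "h\<^sup>2 * (of_int k)\<^sup>2 = r" by blast
  have sub: "{m::int. h\<^sup>2 * (of_int m)\<^sup>2 = r} \<subseteq> {k, -k}"
  proof
    fix m :: int assume "m \<in> {m. h\<^sup>2 * (of_int m)\<^sup>2 = r}"
    then have "h\<^sup>2 * (of_int m)\<^sup>2 = h\<^sup>2 * (of_int k)\<^sup>2" using k by simp
    then have "(of_int m)\<^sup>2 = (of_int k :: real)\<^sup>2" using assms by simp
    then have "m\<^sup>2 = k\<^sup>2" by (metis of_int_eq_iff of_int_power)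
    then show "m \<in> {k, -k}" by (simp add: power2_eq_iff)
  qed
  have "card {k, -k} \<le> 2" by (simp add: card_insert_if)
  then show ?thesis using card_mono[OF _ sub] finite_subset[OF sub] by simp
qed simp

text \<open>This bounds the double counting when two intervals share an end point: a point
  \<open>y\<close> fixes the square of \<open>m\<close>, hence \<open>m\<close> up to sign.\<close>

lemma lattice_points_singleton:
  assumes "h > 0"
  shows "finite (lattice_points h {y}) \<and> card (lattice_points h {y}) \<le> 2"
proof -
  let ?M = "{m::int. h\<^sup>2 * (of_int m)\<^sup>2 = R y}"
  have sub: "lattice_points h {y} \<subseteq> ?M \<times> {y}"
    by (auto simp: lattice_points_def)
  have "finite (?M \<times> {y})" "card (?M \<times> {y}) \<le> 2"
    using modes_over_point[OF assms] by (auto simp: card_cartesian_product)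
  then show ?thesis using card_mono[OF _ sub] finite_subset[OF sub] by force
qed

text \<open>The open interval keeps the divisions of adjacent intervals disjoint.\<close>

definition variation_attains :: "real \<Rightarrow> real \<Rightarrow> real \<Rightarrow> bool" where
  "variation_attains a b V \<longleftrightarrow> (\<forall>e>0. \<exists>d. d division_of \<Union>d \<and>
      \<Union>d \<subseteq> {y. a < y \<and> y < b \<and> R y > 0} \<and>
      V - e < (\<Sum>K\<in>d. \<bar>sqrt (R (Sup K)) - sqrt (R (Inf K))\<bar>))"

text \<open>The union of a division for each interval, both with error \<open>e / 2\<close>, serves
  for the whole; the point \<open>b\<close> lies in neither.\<close>

lemma variation_attains_add:
  assumes "variation_attains a b V" "variation_attains b c W" "a \<le> b" "b \<le> c"
  shows "variation_attains a c (V + W)"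
  unfolding variation_attains_def
proof (intro allI impI)
  fix e :: real assume "e > 0"
  then have e2: "e / 2 > 0" by simp
  let ?S = "\<lambda>d. \<Sum>K\<in>d. \<bar>sqrt (R (Sup K)) - sqrt (R (Inf K))\<bar>"
  from assms(1)[unfolded variation_attains_def, rule_format, OF e2] obtain d1 where d1: "d1 division_of \<Union>d1"
    "\<Union>d1 \<subseteq> {y. a < y \<and> y < b \<and> R y > 0}" "V - e/2 < ?S d1"
    by (elim exE conjE) (rule that)
  from assms(2)[unfolded variation_attains_def, rule_format, OF e2] obtain d2 where d2: "d2 division_of \<Union>d2"
    "\<Union>d2 \<subseteq> {y. b < y \<and> y < c \<and> R y > 0}" "W - e/2 < ?S d2"
    by (elim exE conjE) (rule that)
  have disj: "\<Union>d1 \<inter> \<Union>d2 = {}" using d1(2) d2(2) by force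
  then have int: "interior (\<Union>d1) \<inter> interior (\<Union>d2) = {}"
    using interior_subset by blast
  have "(d1 \<union> d2) division_of \<Union>(d1 \<union> d2)"
    using division_disjoint_union[OF d1(1) d2(1) int] by (simp add: Union_Un_distrib)
  moreover have "\<Union>(d1 \<union> d2) \<subseteq> {y. a < y \<and> y < c \<and> R y > 0}"
  proof
    fix y assume "y \<in> \<Union>(d1 \<union> d2)"
    then consider "y \<in> \<Union>d1" | "y \<in> \<Union>d2" by blast
    then show "y \<in> {y. a < y \<and> y < c \<and> R y > 0}"
    proof cases
      case 1
      with d1(2) have "y \<in> {y. a < y \<and> y < b \<and> R y > 0}" by (rule subsetD)
      then show ?thesis using assms(4) by simp
    next
      case 2
      with d2(2) have "y \<in> {y. b < y \<and> y < c \<and> R y > 0}" by (rule subsetD)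
      then show ?thesis using assms(3) by simp
    qed
  qed
  moreover have "V + W - e < ?S (d1 \<union> d2)"
  proof -
    \<comment> \<open>Cells of a division are nonempty, so a common cell would give a common point
      of the two unions.\<close>
    have "d1 \<inter> d2 = {}"
      using disj division_ofD(3)[OF d1(1)] by blast
    then have "?S (d1 \<union> d2) = ?S d1 + ?S d2"
      using d1(1) d2(1) by (intro sum.union_disjoint) (auto simp: division_of_def)
    then show ?thesis using d1(3) d2(3) by simp
  qed
  ultimately show "\<exists>d. d division_of \<Union>d \<and> \<Union>d \<subseteq> {y. a < y \<and> y < c \<and> R y > 0} \<and>
      V + W - e < ?S d" by (intro exI conjI)
qed

text \<open>One number \<open>V\<close> measures the integral of \<open>speed\<close>, the variation
  of \<open>sqrt R\<close> and, up to an error \<open>C\<close> independent of \<open>h\<close>, the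
  number of lattice points. Bundling the three lets a single subdivision argument treat them
  together.\<close>

definition tame :: "real \<Rightarrow> real \<Rightarrow> bool" where
  "tame a b \<longleftrightarrow> (\<exists>V C. (speed has_integral V) {a..b} \<and> variation_attains a b V
    \<and> (\<forall>h>0. finite (lattice_points h {a..b}) \<and>
          \<bar>real (card (lattice_points h {a..b})) - 2 * V / h\<bar> \<le> C))"

lemma tame_trans:
  assumes "tame a b" "tame b c" "a \<le> b" "b \<le> c"
  shows "tame a c"
proof -
  obtain V C where 1: "(speed has_integral V) {a..b}" "variation_attains a b V"
    "\<And>h. h > 0 \<Longrightarrow> finite (lattice_points h {a..b})"
    "\<And>h. h > 0 \<Longrightarrow> \<bar>real (card (lattice_points h {a..b})) - 2 * V / h\<bar> \<le> C"
    using assms(1) unfolding tame_def by metis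
  obtain W D where 2: "(speed has_integral W) {b..c}" "variation_attains b c W"
    "\<And>h. h > 0 \<Longrightarrow> finite (lattice_points h {b..c})"
    "\<And>h. h > 0 \<Longrightarrow> \<bar>real (card (lattice_points h {b..c})) - 2 * W / h\<bar> \<le> D"
    using assms(2) unfolding tame_def by metis
  have split: "{a..c} = {a..b} \<union> {b..c}" "{a..b} \<inter> {b..c} = {b}"
    using assms(3,4) by auto
  have "(speed has_integral V + W) {a..c}"
    using has_integral_combine[OF assms(3,4) 1(1) 2(1)] .
  moreover have "variation_attains a c (V + W)"
    by (rule variation_attains_add[OF 1(2) 2(2) assms(3,4)])
  moreover have "finite (lattice_points h {a..c}) \<and>
      \<bar>real (card (lattice_points h {a..c})) - 2 * (V + W) / h\<bar> \<le> C + D + 2" if "h > 0" for h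
  proof -
    \<comment> \<open>Inclusion and exclusion: the points over \<open>b\<close> are counted on both
      sides, and there are at most two of them. This is the 2 in \<open>C + D + 2\<close>.\<close>
    have "card (lattice_points h {a..b}) + card (lattice_points h {b..c}) =
        card (lattice_points h {a..c}) + card (lattice_points h {b})"
      using card_Un_Int[OF 1(3)[OF that] 2(3)[OF that]]
      by (simp only: split flip: lattice_points_Un lattice_points_Int)
    moreover have "card (lattice_points h {b}) \<le> 2"
      using lattice_points_singleton[OF that] by blast
    moreover have "2 * (V + W) / h = 2 * V / h + 2 * W / h"
      by (simp add: add_divide_distrib distrib_left)
    moreover have "finite (lattice_points h {a..c})"
      unfolding split(1) lattice_points_Un using 1(3)[OF that] 2(3)[OF that] by blast
    ultimately show ?thesis
      using 1(4)[OF that] 2(4)[OF that] by linarith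
  qed
  ultimately show ?thesis unfolding tame_def by blast
qed

text \<open>The derivative is continuous, so a change of sign would force a zero by the intermediate
  value property. The factor \<open>s\<close> lets the increasing and the decreasing case be handled
  at once.\<close>

lemma sign_between_stationary:
  assumes "\<And>x. a < x \<Longrightarrow> x < b \<Longrightarrow> deriv R x \<noteq> 0"
  obtains s where "s = 1 \<or> s = -1" "\<And>x. a < x \<Longrightarrow> x < b \<Longrightarrow> s * deriv R x > 0"
proof (cases "\<exists>x. a < x \<and> x < b \<and> deriv R x < 0")
  case True
  then obtain u where u: "a < u" "u < b" "deriv R u < 0" by blast
  have "deriv R x < 0" if x: "a < x" "x < b" for x
  proof (rule ccontr)
    assume n: "\<not> deriv R x < 0"
    have "connected (deriv R ` {a<..<b})"
      by (intro connected_continuous_image continuous_deriv_R) simp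
    then have "0 \<in> deriv R ` {a<..<b}"
      by (rule connectedD_interval[of _ "deriv R u" "deriv R x"]) (use u x n in auto)
    then show False using assms by auto
  qed
  then show ?thesis using that[of "-1"] by auto
next
  case False
  then show ?thesis using that[of 1] assms by force
qed

text \<open>\<open>s * R\<close> is strictly increasing on the closed interval, so \<open>V\<close>
  is the total rise of \<open>s * root\<close>. The fundamental theorem of calculus gives the
  integral, a single subinterval nearly attains the variation, and projecting to \<open>m\<close>
  reduces the count to integers in a range.\<close>

lemma tame_between_stationary:
  assumes "a \<le> b" and ns: "\<And>x. a < x \<Longrightarrow> x < b \<Longrightarrow> deriv R x \<noteq> 0"
  shows "tame a b"
proof -
  obtain s where s: "s = 1 \<or> s = -1" "\<And>x. a < x \<Longrightarrow> x < b \<Longrightarrow> s * deriv R x > 0"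
    using sign_between_stationary[OF ns] by blast
  have ss: "s * (s * x) = x" for x using s(1) by auto
  \<comment> \<open>The end points \<open>a\<close> and \<open>b\<close> may be stationary: a
    positive derivative in the interior together with continuity suffices.\<close>
  have strict: "s * R x < s * R y" if "a \<le> x" "x < y" "y \<le> b" for x y
  proof (rule DERIV_pos_imp_increasing_open[OF that(2)])
    fix z assume "x < z" "z < y"
    then show "\<exists>d. DERIV (\<lambda>y. s * R y) z :> d \<and> d > 0"
      using that s(2)[of z] DERIV_cmult[OF R_deriv[of z], of s] by auto
  qed (intro continuous_intros continuous_R)
  have inj: "x = y" if "x \<in> {a..b}" "y \<in> {a..b}" "R x = R y" for x y
    using strict[of x y] strict[of y x] that by (cases x y rule: linorder_cases) auto
  have mono: "s * root x \<le> s * root y" if "a \<le> x" "x \<le> y" "y \<le> b" for x y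
  proof (cases "x = y")
    case False
    then show ?thesis using strict[of x y] that s(1) by (auto simp: root_def)
  qed simp
  define V where "V = s * root b - s * root a"
  have V0: "V \<ge> 0" unfolding V_def using mono[of a b] assms(1) by simp
  define lo where "lo = min (root a) (root b)"
  define hi where "hi = max (root a) (root b)"
  have lohi: "0 \<le> lo" "lo \<le> hi" "hi - lo = V"
    using mono[of a b] assms(1) s(1) unfolding V_def lo_def hi_def by (auto simp: root_def)
  have between: "lo \<le> root y \<and> root y \<le> hi" if "y \<in> {a..b}" for y
    using mono[of a y] mono[of y b] that s(1) unfolding lo_def hi_def by auto
  \<comment> \<open>The strict bounds on \<open>u\<close> exclude both end points, so the preimage
    is interior and therefore not stationary.\<close>
  have hits: "\<exists>y. a < y \<and> y < b \<and> root y = u" if u: "lo < u" "u < hi" for u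
  proof -
    have "connected (root ` {a..b})"
      by (intro connected_continuous_image continuous_root) simp
    then have "u \<in> root ` {a..b}"
      by (rule connectedD_interval[of _ lo hi])
         (use u assms(1) in \<open>auto simp: lo_def hi_def min_def max_def\<close>)
    then obtain y where y: "a \<le> y" "y \<le> b" "root y = u" by auto
    then have "y \<noteq> a" "y \<noteq> b" using u by (auto simp: lo_def hi_def)
    then show ?thesis using y by (intro exI[of _ y]) auto
  qed
  \<comment> \<open>\<open>root\<close> may fail to be differentiable at a zero of \<open>R\<close>;
    by injectivity there is at most one in the interval, and a finite exceptional set is
    harmless.\<close>
  have int: "(speed has_integral V) {a..b}"
    unfolding V_def
  proof (rule fundamental_theorem_of_calculus_interior_strong[where S = "{x \<in> {a..b}. R x = 0}"])
    show "finite {x \<in> {a..b}. R x = 0}"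
    proof (cases "{x \<in> {a..b}. R x = 0} = {}")
      case False
      then obtain z where z: "z \<in> {a..b}" "R z = 0" by auto
      then have "{x \<in> {a..b}. R x = 0} \<subseteq> {z}" using inj by auto
      then show ?thesis by (rule finite_subset) simp
    qed (simp only: finite.emptyI)
    fix x assume "x \<in> {a<..<b} - {x \<in> {a..b}. R x = 0}"
    then have x: "a < x" "x < b" "R x \<noteq> 0" by auto
    have "s * (if R x > 0 then deriv R x / (2 * sqrt (R x)) else 0) = speed x"
      using s(2)[OF x(1,2)] s(1) by (auto simp: speed_def)
    then show "((\<lambda>x. s * root x) has_vector_derivative speed x) (at x)"
      using DERIV_cmult[OF root_deriv[OF x(3)], of s]
      by (simp add: has_real_derivative_iff_has_vector_derivative)
  qed (use assms(1) in \<open>auto intro!: continuous_intros continuous_root\<close>)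
  have tv: "variation_attains a b V"
    unfolding variation_attains_def
  proof (intro allI impI)
    fix e :: real assume "e > 0"
    show "\<exists>d. d division_of \<Union>d \<and> \<Union>d \<subseteq> {y. a < y \<and> y < b \<and> R y > 0} \<and>
      V - e < (\<Sum>K\<in>d. \<bar>sqrt (R (Sup K)) - sqrt (R (Inf K))\<bar>)"
    proof (cases "V = 0")
      case True
      show ?thesis using \<open>e > 0\<close> True by (intro exI[of _ "{}"]) auto
    next
      case False
      \<comment> \<open>Stopping at the levels \<open>lo + t\<close> and \<open>hi - t\<close> loses
        \<open>2 * t\<close> of the variation, less than \<open>e\<close>. The bound
        \<open>2 * t < V\<close> keeps the levels in order, and both are positive, so
        \<open>R > 0\<close> at \<open>u\<close> and \<open>v\<close>.\<close>
      define t where "t = min e V / 3"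
      have t: "t > 0" "2 * t < e" "2 * t < V" using \<open>e > 0\<close> False V0 unfolding t_def by auto
      obtain u where u: "a < u" "u < b" "root u = lo + t"
        using hits[of "lo + t"] t lohi by auto
      obtain v where v: "a < v" "v < b" "root v = hi - t"
        using hits[of "hi - t"] t lohi by auto
      have pos: "R u > 0" "R v > 0"
        using root_pos[of u] root_pos[of v] u(3) v(3) t lohi by auto
      \<comment> \<open>Which of \<open>u\<close> and \<open>v\<close> comes first depends on the
        sign \<open>s\<close>.\<close>
      define c where "c = min u v"
      define c' where "c' = max u v"
      have c: "a < c" "c \<le> c'" "c' < b" using u v by (auto simp: c_def c'_def)
      have posK: "R y > 0" if "y \<in> {c..c'}" for y
      proof -
        have "s * R c \<le> s * R y" "s * R y \<le> s * R c'"
          using strict[of c y] strict[of y c'] that c by (cases "c = y"; cases "y = c'"; auto)+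
        moreover have "R c > 0" "R c' > 0" using pos by (auto simp: c_def c'_def min_def max_def)
        ultimately show ?thesis using s(1) by auto
      qed
      have "\<bar>sqrt (R c') - sqrt (R c)\<bar> = \<bar>root u - root v\<bar>"
        using pos by (auto simp: c_def c'_def min_def max_def root_def)
      then have large: "V - e < \<bar>sqrt (R c') - sqrt (R c)\<bar>" using u v t lohi by auto
      have div: "{cbox c c'} division_of \<Union>{cbox c c'}"
        using division_of_self[of c c'] c by simp
      have sub: "\<Union>{cbox c c'} \<subseteq> {y. a < y \<and> y < b \<and> R y > 0}"
        using c posK by auto
      have "(\<Sum>K\<in>{cbox c c'}. \<bar>sqrt (R (Sup K)) - sqrt (R (Inf K))\<bar>)
          = \<bar>sqrt (R c') - sqrt (R c)\<bar>"
        using c(2) by simp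
      with large have "V - e < (\<Sum>K\<in>{cbox c c'}. \<bar>sqrt (R (Sup K)) - sqrt (R (Inf K))\<bar>)"
        by (simp only:)
      with div sub show ?thesis by (intro exI conjI)
    qed
  qed
  have cnt: "finite (lattice_points h {a..b}) \<and>
      \<bar>real (card (lattice_points h {a..b})) - 2 * V / h\<bar> \<le> 2" if h: "h > 0" for h
  proof -
    let ?L = "lattice_points h {a..b}"
    \<comment> \<open>The modes occurring over the interval contain \<open>?O\<close> and are
      contained in \<open>?C\<close>; the cardinalities of both sets give bounds within 2 of
      \<open>2 * V / h\<close>.\<close>
    let ?O = "{m::int. lo / h < \<bar>of_int m\<bar> \<and> \<bar>of_int m\<bar> < hi / h}"
    let ?C = "{m::int. lo / h \<le> \<bar>of_int m\<bar> \<and> \<bar>of_int m\<bar> \<le> hi / h}"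
    have level: "root y = h * \<bar>of_int m\<bar>" if "h\<^sup>2 * (of_int m)\<^sup>2 = R y" for m :: int and y
    proof -
      have "root y = sqrt ((h * of_int m)\<^sup>2)"
        by (simp add: root_def power_mult_distrib flip: that)
      then show ?thesis using h by (simp add: real_sqrt_abs abs_mult)
    qed
    have injL: "inj_on fst ?L"
      using inj by (fastforce simp: inj_on_def lattice_points_def)
    have up: "fst ` ?L \<subseteq> ?C"
    proof -
      have "m \<in> ?C" if "(m, y) \<in> ?L" for m y
      proof -
        have "y \<in> {a..b}" "root y = h * \<bar>of_int m\<bar>"
          using that level by (auto simp: lattice_points_def)
        then show ?thesis using between[of y] h by (auto simp: field_simps)
      qed
      then show ?thesis by auto
    qed
    have down: "?O \<subseteq> fst ` ?L"
    proof
      fix m assume "m \<in> ?O"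
      then have "lo < h * \<bar>of_int m\<bar>" "h * \<bar>of_int m\<bar> < hi" using h by (auto simp: field_simps)
      from hits[OF this] obtain y where y: "a < y" "y < b" "root y = h * \<bar>of_int m\<bar>" by blast
      \<comment> \<open>Here \<open>root y\<close> exceeds \<open>lo\<close>, hence is positive, so
        the clipping at 0 is inactive and \<open>R y\<close> is the square of
        \<open>root y\<close>.\<close>
      have "R y > 0"
        using root_pos[of y] y(3) \<open>lo < h * \<bar>of_int m\<bar>\<close> lohi(1) by auto
      then have "R y = (root y)\<^sup>2" by (simp add: root_def)
      then have "h\<^sup>2 * (of_int m)\<^sup>2 = R y" using y(3) by (simp add: power_mult_distrib)
      then have "(m, y) \<in> ?L" using y ns by (simp add: lattice_points_def)
      then show "m \<in> fst ` ?L" by force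
    qed
    have q: "0 \<le> lo / h" "lo / h \<le> hi / h" using lohi h by (auto simp: divide_right_mono)
    have d: "hi / h - lo / h = V / h" using lohi by (simp add: diff_divide_distrib[symmetric])
    have finL: "finite ?L"
      using finite_imageD[OF finite_subset[OF up card_integers_between(1)[OF q]] injL] .
    have "card ?L = card (fst ` ?L)" using card_image[OF injL] by simp
    then have "card ?O \<le> card ?L" "card ?L \<le> card ?C"
      using card_mono[OF card_integers_between(1)[OF q] up] card_mono[OF finite_imageI[OF finL] down]
      by simp_all
    then show ?thesis
      using card_integers_between(2,3)[OF q] d finL by (auto simp: abs_le_iff)
  qed
  show ?thesis unfolding tame_def using int tv cnt by blast
qed

text \<open>A short interval around \<open>x\<close> contains no stationary point except possibly
  \<open>x\<close>. Cutting it there makes both halves tame, and bisection passes from these local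
  statements to the whole interval.\<close>

lemma tame_circle: "tame 0 (2 * pi)"
proof -
  have fin: "finite {y \<in> {0..2 * pi}. deriv R y = 0}"
    by (rule finite_subset[OF _ finite.insertI[OF finite_stationary, of "2 * pi"]])
       (auto simp: circle_def)
  \<comment> \<open>The property for the bisection is guarded by containment in
    \<open>{0..2 * pi}\<close>, where finiteness of the stationary points is available.\<close>
  have "0 \<le> (0::real) \<and> 2 * pi \<le> 2 * pi \<longrightarrow> tame 0 (2 * pi)"
  proof (rule Bolzano[where P = "\<lambda>a b. 0 \<le> a \<and> b \<le> 2 * pi \<longrightarrow> tame a b"])
    fix x :: real
    obtain d where d: "d > 0"
      "\<And>y. 0 \<le> y \<Longrightarrow> y \<le> 2 * pi \<Longrightarrow> \<bar>x - y\<bar> < d \<Longrightarrow> y \<noteq> x \<Longrightarrow> deriv R y \<noteq> 0"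
      using finite_set_avoid[OF fin, of x] by (fastforce simp: dist_real_def)
    have "tame a b" if "a \<le> x" "x \<le> b" "b - a < d" "0 \<le> a" "b \<le> 2 * pi" for a b
    proof (rule tame_trans[of a x b])
      show "tame a x"
        by (rule tame_between_stationary) (use d(2) that in \<open>auto simp: dist_real_def\<close>)
      show "tame x b"
        by (rule tame_between_stationary) (use d(2) that in \<open>auto simp: dist_real_def\<close>)
    qed (use that in auto)
    then show "\<exists>d>0. \<forall>a b. a \<le> x \<and> x \<le> b \<and> b - a < d \<longrightarrow> 0 \<le> a \<and> b \<le> 2 * pi \<longrightarrow> tame a b"
      using d(1) by blast
  next
    fix a b c :: real
    assume "0 \<le> a \<and> b \<le> 2 * pi \<longrightarrow> tame a b" "0 \<le> b \<and> c \<le> 2 * pi \<longrightarrow> tame b c" "a \<le> b" "b \<le> c"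
    then show "0 \<le> a \<and> c \<le> 2 * pi \<longrightarrow> tame a c" using tame_trans[of a b c] by auto
  qed simp
  then show ?thesis by simp
qed

end

section \<open>Point count on the circle, reduced volume and total variation\<close>

context regular_symbol
begin

lemma speed_nonneg: "speed y \<ge> 0"
  by (simp add: speed_def)

text \<open>Passing to the half-open \<open>circle\<close> drops only the points over
  \<open>2 * pi\<close>, at most two, which the constant absorbs.\<close>

lemma circle_asymptotics:
  obtains V C where "(speed has_integral V) {0..2 * pi}" "variation_attains 0 (2 * pi) V"
    "\<And>h. h > 0 \<Longrightarrow> finite (lattice_points h circle)"
    "\<And>h. h > 0 \<Longrightarrow> \<bar>real (card (lattice_points h circle)) - 2 * V / h\<bar> \<le> C"
proof -
  obtain V C where VC: "(speed has_integral V) {0..2 * pi}" "variation_attains 0 (2 * pi) V"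
    "\<And>h. h > 0 \<Longrightarrow> finite (lattice_points h {0..2 * pi})"
    "\<And>h. h > 0 \<Longrightarrow> \<bar>real (card (lattice_points h {0..2 * pi})) - 2 * V / h\<bar> \<le> C"
    using tame_circle unfolding tame_def by metis
  have split: "circle \<union> {2 * pi} = {0..2 * pi}"
    by (auto simp: circle_def)
  have fin: "finite (lattice_points h circle)" if "h > 0" for h
    using VC(3)[OF that] unfolding split[symmetric] lattice_points_Un by simp
  show thesis
  proof (rule that[OF VC(1,2) fin])
    fix h :: real assume h: "h > 0"
    have "card (lattice_points h circle) \<le> card (lattice_points h {0..2 * pi})"
      using VC(3)[OF h] by (intro card_mono) (auto simp: lattice_points_def circle_def)
    moreover have "card (lattice_points h {0..2 * pi}) \<le>
        card (lattice_points h circle) + card (lattice_points h {2 * pi})"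
      unfolding split[symmetric] lattice_points_Un by (rule card_Un_le)
    moreover have "card (lattice_points h {2 * pi}) \<le> 2"
      using lattice_points_singleton[OF h] by blast
    ultimately show "\<bar>real (card (lattice_points h circle)) - 2 * V / h\<bar> \<le> C + 2"
      using VC(4)[OF h] by linarith
  qed
qed

lemma positive_part_sets: "positive_part R \<in> sets borel"
proof -
  have "positive_part R = circle \<inter> R -` {0<..}"
    by (auto simp: positive_part_def)
  moreover have "open (R -` {0<..})"
    using continuous_R[of UNIV] by (simp add: continuous_on_open_vimage)
  ultimately show ?thesis by (simp add: circle_def)
qed

text \<open>\<open>V\<close> is a gauge integral, while the volume is a Lebesgue integral whose
  integrand may be unbounded near zeros of \<open>R\<close>. Nonnegativity of \<open>speed\<close>
  makes the gauge integral absolutely convergent, and Borel measurability transfers it from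
  \<open>lebesgue\<close> to \<open>lborel\<close>.\<close>

lemma reduced_volume_eq:
  assumes "(speed has_integral V) {0..2 * pi}"
  shows "set_integrable lborel (positive_part R) (\<lambda>y. \<bar>deriv R y\<bar> / sqrt (R y))"
    and "reduced_volume R = 4 * pi * V"
proof -
  let ?g = "\<lambda>y. \<bar>deriv R y\<bar> / sqrt (R y)"
  let ?P = "positive_part R"
  have g: "?g y = 2 * speed y" if "y \<in> ?P" for y
    using that by (simp add: speed_def positive_part_def)
  have sub: "?P \<subseteq> {0..2 * pi}" by (auto simp: positive_part_def circle_def)
  have meas: "?g \<in> borel_measurable borel"
    by (intro borel_measurable_divide borel_measurable_continuous_onI
        continuous_intros continuous_R continuous_deriv_R)
  have ind: "(\<lambda>y. indicat_real ?P y *\<^sub>R ?g y) \<in> borel_measurable lborel"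
    using positive_part_sets
    by (intro borel_measurable_scaleR borel_measurable_indicator) (simp_all add: meas)
  have two: "((\<lambda>y. 2 * speed y) has_integral 2 * V) {0..2 * pi}"
    using has_integral_mult_right[OF assms, of 2] by simp
  have "set_integrable lebesgue {0..2 * pi} (\<lambda>y. 2 * speed y)"
    by (rule nonnegative_absolutely_integrable_1[OF has_integral_integrable[OF two]])
       (simp add: speed_nonneg)
  then have "set_integrable lebesgue ?P (\<lambda>y. 2 * speed y)"
    by (rule set_integrable_subset[OF _ _ sub])
       (simp add: sets_completionI_sets positive_part_sets)
  then have leb: "set_integrable lebesgue ?P ?g"
    using set_integrable_cong[of lebesgue lebesgue ?P ?P ?g "\<lambda>y. 2 * speed y", OF refl refl g]
    by (simp only:)
  then show int: "set_integrable lborel ?P ?g"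
    unfolding set_integrable_def using integrable_completion[OF ind] by simp
  have "(LBINT y:?P. ?g y) = (LINT y:?P|lebesgue. ?g y)"
    unfolding set_lebesgue_integral_def using integral_completion[OF ind] by simp
  also have "\<dots> = integral ?P ?g"
    using set_lebesgue_integral_eq_integral(2)[OF leb] .
  also have "\<dots> = 2 * V"
  proof (rule integral_unique)
    \<comment> \<open>The integrands can differ only at \<open>2 * pi\<close>, which is not in
      \<open>circle\<close>.\<close>
    have "((\<lambda>y. if y \<in> ?P then ?g y else 0) has_integral 2 * V) {0..2 * pi}"
    proof (rule has_integral_spike_finite[OF _ _ two])
      fix y assume "y \<in> {0..2 * pi} - {2 * pi}"
      then show "(if y \<in> ?P then ?g y else 0) = 2 * speed y"
        by (auto simp: positive_part_def circle_def speed_def)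
    qed simp
    then show "(?g has_integral 2 * V) ?P"
      using has_integral_restrict[OF sub] by blast
  qed
  finally show "reduced_volume R = 4 * pi * V"
    by (simp add: reduced_volume_def)
qed

lemma sqrt_increment_le:
  assumes "u \<le> v" "\<And>y. y \<in> {u..v} \<Longrightarrow> R y > 0" "speed integrable_on {u..v}"
  shows "\<bar>sqrt (R v) - sqrt (R u)\<bar> \<le> integral {u..v} speed"
proof -
  let ?f = "\<lambda>y. deriv R y / (2 * sqrt (R y))"
  have bound: "norm (?f y) \<le> speed y" if "y \<in> {u..v}" for y
    using assms(2)[OF that] by (simp add: speed_def)
  have int: "(?f has_integral sqrt (R v) - sqrt (R u)) {u..v}"
  proof (rule fundamental_theorem_of_calculus[OF assms(1)])
    fix x assume x: "x \<in> {u..v}"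
    have "((\<lambda>y. sqrt (R y)) has_real_derivative ?f x) (at x)"
      using assms(2)[OF x] by (auto intro!: derivative_eq_intros R_deriv simp: field_simps)
    then show "((\<lambda>y. sqrt (R y)) has_vector_derivative ?f x) (at x within {u..v})"
      using has_vector_derivative_at_within
      by (auto simp: has_real_derivative_iff_has_vector_derivative)
  qed
  have "norm (integral {u..v} ?f) \<le> integral {u..v} speed"
    by (rule integral_norm_bound_integral[OF has_integral_integrable[OF int] assms(3) bound])
  then show ?thesis by (simp add: integral_unique[OF int])
qed

text \<open>Each increment is at most the integral of \<open>speed\<close> over its cell, and the
  cells do not overlap, so \<open>V\<close> is an upper bound. The divisions from
  \<open>variation_attains\<close> come arbitrarily close to it.\<close>

lemma total_variation_eq:
  assumes V: "(speed has_integral V) {0..2 * pi}" "variation_attains 0 (2 * pi) V"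
  shows "total_variation (positive_part R) (\<lambda>y. sqrt (R y)) = ennreal V"
proof (rule antisym)
  let ?S = "\<lambda>d. \<Sum>K\<in>d. \<bar>sqrt (R (Sup K)) - sqrt (R (Inf K))\<bar>"
  let ?P = "positive_part R"
  have sub: "?P \<subseteq> {0..2 * pi}" by (auto simp: positive_part_def circle_def)
  show le: "total_variation ?P (\<lambda>y. sqrt (R y)) \<le> ennreal V"
    unfolding total_variation_def
  proof (rule SUP_least)
    fix d assume "d \<in> {d. d division_of \<Union>d \<and> \<Union>d \<subseteq> ?P}"
    then have d: "d division_of \<Union>d" "\<Union>d \<subseteq> ?P" by auto
    have K: "(speed has_integral integral K speed) K \<and>
        \<bar>sqrt (R (Sup K)) - sqrt (R (Inf K))\<bar> \<le> integral K speed" if "K \<in> d" for K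
    proof -
      obtain u v where "K = cbox u v" "K \<noteq> {}"
        using division_ofD(3,4)[OF d(1) \<open>K \<in> d\<close>] by blast
      then have uv: "K = {u..v}" "u \<le> v" by auto
      have pos: "R y > 0" if "y \<in> {u..v}" for y
      proof -
        have "y \<in> ?P" using that uv(1) \<open>K \<in> d\<close> d(2) by blast
        then show ?thesis by (simp add: positive_part_def)
      qed
      have "{u..v} \<subseteq> {0..2 * pi}" using that d(2) sub uv(1) by blast
      then have int: "speed integrable_on {u..v}"
        using integrable_on_subinterval[OF has_integral_integrable[OF V(1)]] by blast
      show ?thesis
        using sqrt_increment_le[OF uv(2) pos int] integrable_integral[OF int] uv by simp
    qed
    have "(speed has_integral (\<Sum>K\<in>d. integral K speed)) (\<Union>d)"
      using K by (intro has_integral_combine_division[OF d(1)]) blast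
    then have "(\<Sum>K\<in>d. integral K speed) \<le> V"
      using has_integral_subset_le[OF _ _ V(1)] d(2) sub speed_nonneg by blast
    moreover have "?S d \<le> (\<Sum>K\<in>d. integral K speed)"
      using K by (intro sum_mono) blast
    ultimately show "ennreal (?S d) \<le> ennreal V"
      by (intro ennreal_leI) linarith
  qed
  show "ennreal V \<le> total_variation ?P (\<lambda>y. sqrt (R y))"
  proof (rule ccontr)
    assume "\<not> ennreal V \<le> total_variation ?P (\<lambda>y. sqrt (R y))"
    \<comment> \<open>The upper bound makes the variation finite, so it is a real
      \<open>t < V\<close>; the gap \<open>V - t\<close> is then used as the error.\<close>
    then obtain t where t: "t \<ge> 0" "total_variation ?P (\<lambda>y. sqrt (R y)) = ennreal t" "t < V"
      using le by (cases "total_variation ?P (\<lambda>y. sqrt (R y))") (auto simp: ennreal_less_iff not_le)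
    then have "V - t > 0" by simp
    from V(2)[unfolded variation_attains_def, rule_format, OF this] obtain d
      where d: "d division_of \<Union>d" "\<Union>d \<subseteq> {y. 0 < y \<and> y < 2 * pi \<and> R y > 0}" "V - (V - t) < ?S d"
      by (elim exE conjE) (rule that)
    have "\<Union>d \<subseteq> ?P" using d(2) by (rule order_trans) (auto simp: positive_part_def circle_def)
    then have "ennreal (?S d) \<le> total_variation ?P (\<lambda>y. sqrt (R y))"
      unfolding total_variation_def using d(1) by (intro SUP_upper2[OF _ order_refl]) simp
    then have "?S d \<le> t" using t by (simp add: ennreal_le_iff)
    then show False using d(3) by simp
  qed
qed

end

section \<open>Dimensions of the sectors\<close>

text \<open>Differentiating \<open>poly q (cis z)\<close> replaces \<open>q\<close> by
  \<open>\<i>\<close> times the variable times \<open>pderiv q\<close>, so iterating this operator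
  on polynomials yields all derivatives.\<close>

lemma smooth_on_circle_trig_poly: "smooth_on_circle (\<lambda>z. poly p (cis z))"
proof -
  define D where "D n = (\<lambda>z. poly (((\<lambda>q. [:0, \<i>:] * pderiv q) ^^ n) p) (cis z))" for n
  have deriv: "((\<lambda>z. poly q (cis z)) has_vector_derivative poly ([:0, \<i>:] * pderiv q) (cis x)) (at x)"
    for q x
  proof -
    have "((poly q \<circ> cis) has_vector_derivative (\<i> * cis x) * poly (pderiv q) (cis x)) (at x)"
    proof (rule field_vector_diff_chain_at)
      have "((\<lambda>z. exp (\<i> * z)) has_field_derivative \<i> * exp (\<i> * of_real x)) (at (of_real x))"
        by (auto intro!: derivative_eq_intros)
      then show "(cis has_vector_derivative \<i> * cis x) (at x)"
        unfolding cis_conv_exp by (rule has_vector_derivative_real_field)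
    qed (rule poly_DERIV)
    then show ?thesis by (simp add: o_def mult_ac)
  qed
  have "D 0 = (\<lambda>z. poly p (cis z))" by (simp add: D_def)
  moreover have "(D n has_vector_derivative D (Suc n) x) (at x)" for n x
    using deriv by (simp add: D_def)
  ultimately have "smooth (\<lambda>z. poly p (cis z))"
    unfolding smooth_def by blast
  moreover have "cis (y + 2 * pi) = cis y" for y
    by (simp add: cis.ctr)
  ultimately show ?thesis by (simp add: smooth_on_circle_def)
qed

lemma cis_inj_on_circle: "inj_on cis circle"
proof (rule inj_onI)
  fix x y assume *: "x \<in> circle" "y \<in> circle" "cis x = cis y"
  then have "sin x = sin y \<and> cos x = cos y" by (simp add: complex_eq_iff)
  then obtain n :: int where n: "x = y + 2 * pi * n" using sin_cos_eq_iff by blast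
  have "\<bar>x - y\<bar> < 2 * pi" using * by (auto simp: circle_def)
  then have "2 * pi * \<bar>of_int n\<bar> < 2 * pi * 1" using n by (simp add: abs_mult)
  then have "\<bar>real_of_int n\<bar> < 1" by (subst (asm) mult_less_cancel_left_pos) auto
  then have "n = 0" by linarith
  then show "x = y" using n by simp
qed

text \<open>Lagrange interpolation in the variable \<open>cis y\<close>, placed in the single mode
  \<open>fst i\<close>. Points of \<open>I\<close> with another mode see the zero function, and
  those with the same mode are roots of \<open>q\<close>.\<close>

lemma obtain_test_function:
  assumes "finite I" "I \<subseteq> UNIV \<times> circle" "i \<in> I"
  obtains f where "f \<in> Phi" "modes f (fst i) (snd i) = c"
    "\<And>j. j \<in> I \<Longrightarrow> j \<noteq> i \<Longrightarrow> modes f (fst j) (snd j) = 0"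
proof -
  define q where "q = (\<Prod>y\<in>snd ` I - {snd i}. [:- cis y, 1:])"
  have q: "poly q z = (\<Prod>y\<in>snd ` I - {snd i}. z - cis y)" for z
    by (simp add: q_def poly_prod)
  have nz: "poly q (cis (snd i)) \<noteq> 0"
  proof -
    have "cis (snd i) \<noteq> cis y" if "y \<in> snd ` I - {snd i}" for y
    proof
      assume eq: "cis (snd i) = cis y"
      have "snd i \<in> circle" "y \<in> circle" using that assms(2,3) by auto
      then show False using inj_onD[OF cis_inj_on_circle eq] that by simp
    qed
    then show ?thesis unfolding q using assms(1) by auto
  qed
  define F where "F = (\<lambda>m z. poly (if m = fst i then smult (c / poly q (cis (snd i))) q else 0) (cis z))"
  have "F m = 0" if "m \<noteq> fst i" for m
    using that by (auto simp: F_def)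
  then have "{m. F m \<noteq> 0} \<subseteq> {fst i}" by blast
  then have "finite {m. F m \<noteq> 0}" by (rule finite_subset) simp
  then have F: "mode_family F"
    unfolding mode_family_def using smooth_on_circle_trig_poly by (simp add: F_def)
  have modes: "modes (mode_sum F) m y =
      poly (if m = fst i then smult (c / poly q (cis (snd i))) q else 0) (cis y)" for m y
    unfolding modes_mode_sum[OF F] by (simp add: F_def)
  show thesis
  proof (rule that)
    show "mode_sum F \<in> Phi" using F by (auto simp: Phi_def)
    show "modes (mode_sum F) (fst i) (snd i) = c"
      using nz by (simp add: modes)
    fix j assume j: "j \<in> I" "j \<noteq> i"
    show "modes (mode_sum F) (fst j) (snd j) = 0"
    proof (cases "fst j = fst i")
      case True
      then have "snd j \<in> snd ` I - {snd i}" using j by (auto simp: prod_eq_iff)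
      then have "poly q (cis (snd j)) = 0"
        unfolding q using assms(1) by (intro prod_zero) auto
      then show ?thesis by (simp add: modes)
    qed (simp add: modes)
  qed
qed

section \<open>Point evaluations and the range of the rigging map\<close>

lemma sum_functions_apply: "(\<Sum>i\<in>I. F i) x = (\<Sum>i\<in>I. F i x)"
  for F :: "'i \<Rightarrow> 'a \<Rightarrow> 'b::comm_monoid_add"
  by (induction I rule: infinite_finite_induct) auto

definition point_eval :: "int \<times> real \<Rightarrow> functional" where
  "point_eval i = (\<lambda>g. if g \<in> Phi then modes g (fst i) (snd i) else 0)"

text \<open>The test functions are dual to the evaluations: applying a vanishing combination to the
  one for \<open>i\<close> isolates its coefficient.\<close>

lemma point_eval_independent:
  assumes "finite I" "I \<subseteq> UNIV \<times> circle"
  shows "inj_on point_eval I" "functionals.independent (point_eval ` I)"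
proof -
  have test: "\<exists>f. \<forall>j\<in>I. point_eval j f = (if j = i then 1 else 0)" if "i \<in> I" for i
  proof -
    obtain f where "f \<in> Phi" "modes f (fst i) (snd i) = 1"
      "\<And>j. j \<in> I \<Longrightarrow> j \<noteq> i \<Longrightarrow> modes f (fst j) (snd j) = 0"
      using obtain_test_function[OF assms \<open>i \<in> I\<close>, of 1] by metis
    then show ?thesis by (intro exI[of _ f]) (simp add: point_eval_def)
  qed
  show inj: "inj_on point_eval I"
    by (rule inj_onI) (metis test zero_neq_one)
  have scalars: "u x = 0" if sum: "(\<Sum>x\<in>point_eval ` I. scale_functional (u x) x) = 0"
    and x: "x \<in> point_eval ` I" for u x
  proof -
    from x obtain i where i: "i \<in> I" "x = point_eval i" by blast
    obtain f where f: "\<forall>j\<in>I. point_eval j f = (if j = i then 1 else 0)"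
      using test[OF i(1)] by blast
    have "0 = (\<Sum>x\<in>point_eval ` I. scale_functional (u x) x) f" using sum by simp
    also have "\<dots> = (\<Sum>j\<in>I. u (point_eval j) * point_eval j f)"
      by (simp add: sum.reindex[OF inj] sum_functions_apply scale_functional_def)
    also have "\<dots> = (\<Sum>j\<in>I. if j = i then u (point_eval i) else 0)"
      using f by (intro sum.cong) auto
    also have "\<dots> = u x" using i assms(1) by simp
    finally show ?thesis by (rule sym)
  qed
  have fin: "finite (point_eval ` I)" using assms(1) by simp
  show "functionals.independent (point_eval ` I)"
    unfolding functionals.dependent_finite[OF fin] using scalars by blast
qed

definition support_points :: "(real \<Rightarrow> real) \<Rightarrow> real \<Rightarrow> sector \<Rightarrow> (int \<times> real) set" where
  "support_points R h s = {(m, y). y \<in> Y R h s (nat \<bar>m\<bar>)}"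

definition weight :: "(real \<Rightarrow> real) \<Rightarrow> sector \<Rightarrow> real \<Rightarrow> real" where
  "weight R s y = \<bar>(deriv ^^ sector_order s) R y\<bar> powr (1 / real (sector_order s))"

definition eta_coeff :: "(real \<Rightarrow> real) \<Rightarrow> sector \<Rightarrow> (real \<Rightarrow> real \<Rightarrow> complex) \<Rightarrow> int \<times> real \<Rightarrow> complex" where
  "eta_coeff R s f i = (2 * pi)\<^sup>2 * cnj (modes f (fst i) (snd i)) / of_real (weight R s (snd i))"

lemma support_points_circle: "support_points R h s \<subseteq> UNIV \<times> circle"
  by (cases s) (auto simp: support_points_def solutions_def)

lemma eta_eq_sum_point_eval:
  assumes fin: "finite (support_points R h s)" and f: "f \<in> Phi"
  shows "eta R h s f = (\<Sum>i\<in>support_points R h s. scale_functional (eta_coeff R s f i) (point_eval i))"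
proof
  fix g
  let ?A = "{m. modes f m \<noteq> 0}"
  let ?t = "\<lambda>m y. cnj (modes f m y) * modes g m y / of_real (weight R s y)"
  have finA: "finite ?A" using f by (auto simp: Phi_def modes_mode_sum mode_family_def)
  have finY: "finite (Y R h s (nat \<bar>m\<bar>))" for m
    by (rule finite_subset[OF _ finite_imageI[OF fin, of snd]]) (force simp: support_points_def)
  have "(\<Sum>m\<in>?A. \<Sum>y\<in>Y R h s (nat \<bar>m\<bar>). ?t m y) =
      (\<Sum>i\<in>(SIGMA m:?A. Y R h s (nat \<bar>m\<bar>)). ?t (fst i) (snd i))"
    using finA finY by (simp add: sum.Sigma split_def)
  \<comment> \<open>The added points belong to modes at which \<open>f\<close> vanishes, so they
    contribute 0.\<close>
  also have "\<dots> = (\<Sum>i\<in>support_points R h s. ?t (fst i) (snd i))"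
    by (rule sum.mono_neutral_left[OF fin]) (auto simp: support_points_def)
  finally have *: "(\<Sum>m\<in>?A. \<Sum>y\<in>Y R h s (nat \<bar>m\<bar>). ?t m y) =
    (\<Sum>i\<in>support_points R h s. ?t (fst i) (snd i))" .
  show "eta R h s f g =
      (\<Sum>i\<in>support_points R h s. scale_functional (eta_coeff R s f i) (point_eval i)) g"
  proof (cases "g \<in> Phi")
    case True
    then have "eta R h s f g = (2 * pi)\<^sup>2 * (\<Sum>i\<in>support_points R h s. ?t (fst i) (snd i))"
      unfolding *[symmetric] by (simp add: eta_def weight_def)
    then show ?thesis
      using True by (simp add: sum_functions_apply scale_functional_def point_eval_def
          eta_coeff_def sum_distrib_left mult_ac)
  next
    case False
    then show ?thesis
      by (simp add: sum_functions_apply scale_functional_def point_eval_def eta_def)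
  qed
qed

text \<open>The evaluations at the support points lie in the range of \<open>eta\<close> and span a
  space containing it, so they form a basis.\<close>

lemma dim_H_RAQ:
  assumes fin: "finite (support_points R h s)"
    and w: "\<And>i. i \<in> support_points R h s \<Longrightarrow> weight R s (snd i) \<noteq> 0"
  shows "findim_functionals (H_RAQ R h s)"
    and "functionals.dim (H_RAQ R h s) = card (support_points R h s)"
proof -
  let ?I = "support_points R h s"
  let ?B = "point_eval ` ?I"
  have sub: "H_RAQ R h s \<subseteq> functionals.span ?B"
    unfolding H_RAQ_def
  proof (rule image_subsetI)
    fix f assume "f \<in> Phi"
    then show "eta R h s f \<in> functionals.span ?B"
      by (simp only: eta_eq_sum_point_eval[OF fin])
         (intro functionals.span_sum functionals.span_scale functionals.span_base imageI)
  qed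
  then show "findim_functionals (H_RAQ R h s)"
    unfolding findim_functionals_def using fin by blast
  have "?B \<subseteq> H_RAQ R h s"
  proof
    fix x assume "x \<in> ?B"
    then obtain i where i: "i \<in> ?I" "x = point_eval i" by blast
    \<comment> \<open>The prescribed value cancels the prefactor and the weight in
      \<open>eta_coeff\<close>; being real, it is unchanged by conjugation.\<close>
    obtain f where f: "f \<in> Phi" "modes f (fst i) (snd i) = of_real (weight R s (snd i) / (2 * pi)\<^sup>2)"
      "\<And>j. j \<in> ?I \<Longrightarrow> j \<noteq> i \<Longrightarrow> modes f (fst j) (snd j) = 0"
      using obtain_test_function[OF fin support_points_circle i(1)] by metis
    have "eta_coeff R s f j = (if j = i then 1 else 0)" if "j \<in> ?I" for j
      using f(2) f(3)[OF that] w[OF i(1)] by (cases "j = i") (simp_all add: eta_coeff_def)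
    then have "eta R h s f = (\<Sum>j\<in>?I. if j = i then point_eval i else 0)"
      unfolding eta_eq_sum_point_eval[OF fin f(1)]
      by (intro sum.cong) auto
    also have "\<dots> = x" using i fin by simp
    finally show "x \<in> H_RAQ R h s" unfolding H_RAQ_def using f(1) by blast
  qed
  then show "functionals.dim (H_RAQ R h s) = card ?I"
    using functionals.dim_unique[OF _ sub] point_eval_independent[OF fin support_points_circle]
    by (simp add: card_image)
qed

text \<open>Positive definiteness: the diagonal value is a sum of squared moduli with positive
  weights, so each of them vanishes.\<close>

lemma eta_diagonal_eq_0:
  assumes fin: "finite (support_points R h s)"
    and w: "\<And>i. i \<in> support_points R h s \<Longrightarrow> weight R s (snd i) > 0"
    and f: "f \<in> Phi" "eta R h s f f = 0"
  shows "eta R h s f = 0"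
proof -
  let ?I = "support_points R h s"
  let ?t = "\<lambda>i. (2 * pi)\<^sup>2 * (cmod (modes f (fst i) (snd i)))\<^sup>2 / weight R s (snd i)"
  have "eta R h s f f = (\<Sum>i\<in>?I. eta_coeff R s f i * modes f (fst i) (snd i))"
    using f(1) by (simp add: eta_eq_sum_point_eval[OF fin] sum_functions_apply
        scale_functional_def point_eval_def)
  also have "\<dots> = (\<Sum>i\<in>?I. of_real (?t i))"
    by (intro sum.cong refl)
       (simp add: eta_coeff_def complex_norm_square mult_ac flip: of_real_power)
  also have "\<dots> = of_real (\<Sum>i\<in>?I. ?t i)" by (rule of_real_sum[symmetric])
  finally have "complex_of_real (\<Sum>i\<in>?I. ?t i) = 0"
    using f(2) by (rule trans[OF sym])
  then have "(\<Sum>i\<in>?I. ?t i) = 0" by (rule of_real_eq_0_iff[THEN iffD1])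
  then have "?t i = 0" if "i \<in> ?I" for i
    using sum_nonneg_eq_0_iff[OF fin, of ?t] w that by (simp add: less_imp_le)
  then have "modes f (fst i) (snd i) = 0" if "i \<in> ?I" for i
    using w[OF that] that by fastforce
  then have "eta_coeff R s f i = 0" if "i \<in> ?I" for i
    using that by (simp add: eta_coeff_def)
  then show ?thesis
    unfolding eta_eq_sum_point_eval[OF fin f(1)] by (intro sum.neutral) simp
qed

section \<open>Components of families and the orthogonal complement\<close>

lemma sum_sector_embed:
  "sector_embed s (\<Sum>i\<in>I. scale_functional (c i) (e i)) =
    (\<Sum>i\<in>I. scale_family (c i) (sector_embed s (e i)))"
proof (induction I rule: infinite_finite_induct)
  case (insert i I)
  have embed_add: "sector_embed s (a + b) = sector_embed s a + sector_embed s b" for a b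
    by (auto simp: sector_embed_def fun_eq_iff)
  have embed_scale: "sector_embed s (scale_functional c a) = scale_family c (sector_embed s a)" for c a
    by (auto simp: sector_embed_def scale_family_def scale_functional_def fun_eq_iff)
  show ?case
    by (simp only: sum.insert[OF insert.hyps] embed_add embed_scale insert.IH)
qed (auto simp: sector_embed_def fun_eq_iff)

lemma family_eq_sum_sector_embed:
  assumes "finite {s. \<psi> s \<noteq> 0}"
  shows "\<psi> = (\<Sum>s | \<psi> s \<noteq> 0. sector_embed s (\<psi> s))"
proof
  fix t
  have "(\<Sum>s | \<psi> s \<noteq> 0. sector_embed s (\<psi> s)) t = (\<Sum>s | \<psi> s \<noteq> 0. if s = t then \<psi> t else 0)"
    by (subst sum_functions_apply) (intro sum.cong, auto simp: sector_embed_def)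
  then show "\<psi> t = (\<Sum>s | \<psi> s \<noteq> 0. sector_embed s (\<psi> s)) t"
    using assms by (simp add: sum.delta')
qed

text \<open>Pairing \<open>\<psi>\<close> with its own component in the sector \<open>s\<close>
  gives the squared norm of that component, which orthogonality forces to be 0.\<close>

lemma complement_component_eq_0:
  assumes fin: "finite (support_points R h s)"
    and w: "\<And>i. i \<in> support_points R h s \<Longrightarrow> weight R s (snd i) > 0"
    and \<psi>: "\<psi> \<in> complement_RAQ R h s"
  shows "\<psi> s = 0"
proof (rule ccontr)
  assume nz: "\<psi> s \<noteq> 0"
  have tot: "\<psi> \<in> H_tot R h" and orth: "\<And>a. a \<in> H_RAQ R h s \<Longrightarrow> inner_tot R h (sector_embed s a) \<psi> = 0"
    using \<psi> by (auto simp: complement_RAQ_def)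
  have "s \<in> sectors R h" using tot nz by (auto simp: H_tot_def)
  then have "\<psi> s \<in> H_RAQ R h s" using tot by (auto simp: H_tot_def)
  then obtain f where f: "f \<in> Phi" "\<psi> s = eta R h s f" by (auto simp: H_RAQ_def)
  have "{t. sector_embed s (\<psi> s) t \<noteq> 0} = {s}"
    using nz by (auto simp: sector_embed_def)
  then have "inner_tot R h (sector_embed s (\<psi> s)) \<psi> = inner_RAQ R h s (\<psi> s) (\<psi> s)"
    by (simp add: inner_tot_def sector_embed_def)
  then have "eta R h s f f = 0"
    using orth[OF \<open>\<psi> s \<in> H_RAQ R h s\<close>] f by (simp add: inner_RAQ_eta)
  then show False using eta_diagonal_eq_0[OF fin w f(1)] f(2) nz by simp
qed

context regular_symbol
begin

text \<open>At a stationary point the finite order guarantees that the \<open>LEAST\<close> is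
  attained, so it cannot be the order 1 of a vanishing derivative.\<close>

lemma solution_order_eq_1_iff: "solution_order R y = 1 \<longleftrightarrow> deriv R y \<noteq> 0"
proof
  assume "deriv R y \<noteq> 0"
  then show "solution_order R y = 1"
    unfolding solution_order_def by (intro Least_equality) auto
next
  assume 1: "solution_order R y = 1"
  show "deriv R y \<noteq> 0"
  proof
    assume "deriv R y = 0"
    then have "\<exists>p. 1 \<le> p \<and> (deriv ^^ p) R y \<noteq> 0" using finite_order by blast
    from LeastI_ex[OF this] show False
      using 1 \<open>deriv R y = 0\<close> by (simp add: solution_order_def)
  qed
qed

lemma support_points_regular:
  "support_points R h (Odd_Sector 1) = lattice_points h circle"
  by (auto simp: support_points_def lattice_points_def solutions_def solution_order_eq_1_iff[simplified])

lemma weight_regular_pos: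
  "i \<in> lattice_points h S \<Longrightarrow> weight R (Odd_Sector 1) (snd i) > 0"
  by (auto simp: lattice_points_def weight_def)

definition stationary_points :: "real \<Rightarrow> (int \<times> real) set" where
  "stationary_points h = {(m, y). y \<in> circle \<and> h\<^sup>2 * (of_int m)\<^sup>2 = R y \<and> deriv R y = 0}"

text \<open>The base point alone determines the sector, so a spanning set for the complement can be
  indexed by stationary points without a separate sector label.\<close>

definition sector_at :: "real \<Rightarrow> sector" where
  "sector_at y = (let p = solution_order R y in
    if odd p then Odd_Sector p else Even_Sector p (if (deriv ^^ p) R y > 0 then 1 else -1))"

text \<open>At most two modes lie over each stationary point of \<open>R\<close>; the resulting
  bound does not depend on \<open>h\<close>.\<close>

lemma stationary_points_card:
  assumes "h > 0"
  shows "finite (stationary_points h)"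
    and "card (stationary_points h) \<le> 2 * card {y \<in> circle. deriv R y = 0}"
proof -
  let ?Z = "{y \<in> circle. deriv R y = 0}"
  let ?M = "\<lambda>y. {m::int. h\<^sup>2 * (of_int m)\<^sup>2 = R y}"
  have eq: "stationary_points h = (\<Union>y\<in>?Z. (\<lambda>m. (m, y)) ` ?M y)"
    by (auto simp: stationary_points_def)
  show "finite (stationary_points h)"
    unfolding eq using finite_stationary modes_over_point[OF assms] by blast
  have "card (stationary_points h) \<le> (\<Sum>y\<in>?Z. card ((\<lambda>m. (m, y)) ` ?M y))"
    unfolding eq by (rule card_UN_le[OF finite_stationary])
  also have "\<dots> \<le> (\<Sum>y\<in>?Z. 2)"
  proof (rule sum_mono)
    fix y
    have "card ((\<lambda>m. (m, y)) ` ?M y) \<le> card (?M y)"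
      using modes_over_point[OF assms] by (intro card_image_le) blast
    also have "\<dots> \<le> 2" using modes_over_point[OF assms] by blast
    finally show "card ((\<lambda>m. (m, y)) ` ?M y) \<le> 2" .
  qed
  finally show "card (stationary_points h) \<le> 2 * card ?Z" by simp
qed

lemma support_points_stationary:
  assumes "s \<in> sectors R h" "s \<noteq> Odd_Sector 1" "i \<in> support_points R h s"
  shows "i \<in> stationary_points h \<and> sector_at (snd i) = s"
proof (cases s)
  case (Odd_Sector p)
  then show ?thesis
    using assms solution_order_eq_1_iff[simplified, of "snd i"]
    by (auto simp: support_points_def stationary_points_def solutions_def sectors_def sector_at_def)
next
  case (Even_Sector p e)
  then have p: "even p" "e = 1 \<or> e = -1" using assms(1) by (auto simp: sectors_def)
  then have "p \<noteq> 1" by auto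
  then show ?thesis
    using assms Even_Sector p solution_order_eq_1_iff[simplified, of "snd i"]
    by (auto simp: support_points_def stationary_points_def solutions_def sector_at_def sgn_if
        split: if_splits)
qed

text \<open>The regular component vanishes on the complement. Every other component is a combination
  of evaluations at stationary points, each embedded in the sector of its base point.\<close>

lemma complement_dim:
  assumes h: "h > 0" and fin: "finite (lattice_points h circle)"
  shows "findim_families (complement_RAQ R h (Odd_Sector 1))"
    and "families.dim (complement_RAQ R h (Odd_Sector 1)) \<le> 2 * card {y \<in> circle. deriv R y = 0}"
proof -
  let ?B = "(\<lambda>i. sector_embed (sector_at (snd i)) (point_eval i)) ` stationary_points h"
  have finB: "finite ?B" using stationary_points_card(1)[OF h] by simp
  have sub: "complement_RAQ R h (Odd_Sector 1) \<subseteq> families.span ?B"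
  proof
    fix \<psi> assume \<psi>: "\<psi> \<in> complement_RAQ R h (Odd_Sector 1)"
    then have tot: "\<psi> \<in> H_tot R h" by (simp add: complement_RAQ_def)
    have fin0: "finite {s. \<psi> s \<noteq> 0}" using tot by (simp add: H_tot_def)
    have zero: "\<psi> (Odd_Sector 1) = 0"
      using complement_component_eq_0[OF _ _ \<psi>] fin weight_regular_pos support_points_regular
      by metis
    have "sector_embed s (\<psi> s) \<in> families.span ?B" if "s \<in> {s. \<psi> s \<noteq> 0}" for s
    proof -
      have s: "s \<in> sectors R h" "s \<noteq> Odd_Sector 1"
        using that tot zero by (auto simp: H_tot_def)
      then have "\<psi> s \<in> H_RAQ R h s" using tot by (simp add: H_tot_def)
      then obtain f where f: "f \<in> Phi" "\<psi> s = eta R h s f" by (auto simp: H_RAQ_def)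
      have st: "i \<in> stationary_points h" "sector_at (snd i) = s" if "i \<in> support_points R h s" for i
        using support_points_stationary[OF s that] by auto
      have "finite (support_points R h s)"
        using st(1) stationary_points_card(1)[OF h] by (meson finite_subset subsetI)
      from eta_eq_sum_point_eval[OF this f(1)] show ?thesis
        unfolding f(2)
        by (simp only: sum_sector_embed)
           (intro families.span_sum families.span_scale families.span_base,
            use st in force)
    qed
    then have "(\<Sum>s | \<psi> s \<noteq> 0. sector_embed s (\<psi> s)) \<in> families.span ?B"
      by (rule families.span_sum)
    then show "\<psi> \<in> families.span ?B"
      by (subst family_eq_sum_sector_embed[OF fin0])
  qed
  then show "findim_families (complement_RAQ R h (Odd_Sector 1))"
    unfolding findim_families_def using finB by blast
  have "families.dim (complement_RAQ R h (Odd_Sector 1)) \<le> card ?B"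
    by (rule families.dim_le_card[OF sub finB])
  also have "\<dots> \<le> card (stationary_points h)"
    by (rule card_image_le[OF stationary_points_card(1)[OF h]])
  also have "\<dots> \<le> 2 * card {y \<in> circle. deriv R y = 0}"
    by (rule stationary_points_card(2)[OF h])
  finally show "families.dim (complement_RAQ R h (Odd_Sector 1)) \<le> 2 * card {y \<in> circle. deriv R y = 0}" .
qed

end

text \<open>The count of regular points has an error bounded uniformly in \<open>h\<close>, which
  the factor \<open>2 * pi * h\<close> sends to 0. The bound for the complement is twice the number
  of stationary points.\<close>

theorem mainTheorem5:
  fixes R :: "real \<Rightarrow> real"
  assumes "smooth_on_circle R"
    and "\<exists>y. R y > 0"
    and "finite {y \<in> circle. deriv R y = 0}"
    and "\<And>y. deriv R y = 0 \<Longrightarrow> \<exists>k\<ge>1. (deriv ^^ k) R y \<noteq> 0"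
    and "\<And>y. R y = 0 \<Longrightarrow> deriv R y \<noteq> 0"
  shows "set_integrable lborel (positive_part R) (\<lambda>y. \<bar>deriv R y\<bar> / sqrt (R y))
    \<and> ennreal (reduced_volume R) =
        ennreal (4 * pi) * total_variation (positive_part R) (\<lambda>y. sqrt (R y))
    \<and> (\<forall>\<^sub>F h in semiclassical R. findim_functionals (H_RAQ R h (Odd_Sector 1)))
    \<and> ((\<lambda>h. 2 * pi * h * real (functionals.dim (H_RAQ R h (Odd_Sector 1))))
        \<longlongrightarrow> reduced_volume R) (semiclassical R)
    \<and> (\<exists>C. \<forall>\<^sub>F h in semiclassical R.
        findim_families (complement_RAQ R h (Odd_Sector 1)) \<and>
        families.dim (complement_RAQ R h (Odd_Sector 1)) \<le> C)"
proof -
  interpret regular_symbol R by unfold_locales fact+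
  obtain V C where V: "(speed has_integral V) {0..2 * pi}" "variation_attains 0 (2 * pi) V"
    and fin: "\<And>h. h > 0 \<Longrightarrow> finite (lattice_points h circle)"
    and count: "\<And>h. h > 0 \<Longrightarrow> \<bar>real (card (lattice_points h circle)) - 2 * V / h\<bar> \<le> C"
    by (rule circle_asymptotics) (rule that)
  have V0: "V \<ge> 0" using has_integral_nonneg[OF V(1)] speed_nonneg by blast
  have semi: "\<forall>\<^sub>F h in semiclassical R. P h" if "\<And>h. h > 0 \<Longrightarrow> P h" for P
    unfolding semiclassical_def eventually_at_filter by (auto intro!: always_eventually that)
  have dim: "findim_functionals (H_RAQ R h (Odd_Sector 1)) \<and>
      functionals.dim (H_RAQ R h (Odd_Sector 1)) = card (lattice_points h circle)" if "h > 0" for h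
    using dim_H_RAQ[of R h "Odd_Sector 1", unfolded support_points_regular, OF fin[OF that]]
      weight_regular_pos by (metis less_irrefl)
  have lim: "((\<lambda>h. 2 * pi * h * real (functionals.dim (H_RAQ R h (Odd_Sector 1)))) \<longlongrightarrow> reduced_volume R)
      (semiclassical R)"
  proof (rule Lim_transform2)
    show "((\<lambda>h. reduced_volume R) \<longlongrightarrow> reduced_volume R) (semiclassical R)" by simp
    show "((\<lambda>h. reduced_volume R - 2 * pi * h * real (functionals.dim (H_RAQ R h (Odd_Sector 1)))) \<longlongrightarrow> 0)
        (semiclassical R)"
    proof (rule Lim_null_comparison[OF semi])
      fix h :: real assume h: "h > 0"
      \<comment> \<open>The main term is \<open>2 * pi * h * (2 * V / h) = 4 * pi * V\<close>, the
        reduced volume, so only the counting error remains.\<close>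
      have "reduced_volume R - 2 * pi * h * real (card (lattice_points h circle)) =
          - (2 * pi * h * (real (card (lattice_points h circle)) - 2 * V / h))"
        using h unfolding reduced_volume_eq(2)[OF V(1)] by (simp add: field_simps)
      then have "norm (reduced_volume R - 2 * pi * h * real (card (lattice_points h circle))) =
          2 * pi * h * \<bar>real (card (lattice_points h circle)) - 2 * V / h\<bar>"
        using h by (simp add: abs_mult)
      also have "\<dots> \<le> 2 * pi * h * C"
        using count[OF h] h by (intro mult_left_mono) auto
      finally show "norm (reduced_volume R - 2 * pi * h *
          real (functionals.dim (H_RAQ R h (Odd_Sector 1)))) \<le> 2 * pi * h * C"
        using dim[OF h] by simp
    next
      have "((\<lambda>h. 2 * pi * h * C) \<longlongrightarrow> 2 * pi * 0 * C) (semiclassical R)"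
        unfolding semiclassical_def by (intro tendsto_intros)
      then show "((\<lambda>h. 2 * pi * h * C) \<longlongrightarrow> 0) (semiclassical R)" by simp
    qed
  qed
  have "ennreal (reduced_volume R) =
      ennreal (4 * pi) * total_variation (positive_part R) (\<lambda>y. sqrt (R y))"
    unfolding reduced_volume_eq(2)[OF V(1)] total_variation_eq[OF V]
    using V0 by (simp add: ennreal_mult)
  moreover have "\<forall>\<^sub>F h in semiclassical R. findim_functionals (H_RAQ R h (Odd_Sector 1))"
    using dim by (intro semi) blast
  moreover have "\<forall>\<^sub>F h in semiclassical R.
      findim_families (complement_RAQ R h (Odd_Sector 1)) \<and>
      families.dim (complement_RAQ R h (Odd_Sector 1)) \<le> 2 * card {y \<in> circle. deriv R y = 0}"
    using complement_dim fin by (intro semi conjI) blast+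
  ultimately show ?thesis
    using reduced_volume_eq(1)[OF V(1)] lim by blast
qed

end
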